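(* Let $q,d\ge3$ be integers. As $\ell\to\infty$, $$\int_0^{\pi/2}G_{\ell;d}(\cos\vartheta)^q(\sin\vartheta)^{d-1}\,d\vartheta=\frac{c_{q;d}}{\ell^d}\,(1+o_{q;d}(1)),$$ where the constants $c_{q;d}$ are given by $$c_{q;d}=\left(2^{\frac d2-1}\left(\tfrac d2-1\right)!\right)^q\int_0^{+\infty}J_{\frac d2-1}(\psi)^q\,\psi^{-q\left(\frac d2-1\right)+d-1}\,d\psi .$$ The integral defining $c_{q;d}$ is absolutely convergent for any pair $(d,q)\neq(3,3)$ and conditionally convergent for $d=q=3$.
   Context: $G_{\ell;d}$ is the normalized Gegenbauer polynomial $G_{\ell;d}=P_\ell^{(\frac d2-1,\frac d2-1)}/\binom{\ell+\frac d2-1}{\ell}$, with $P_\ell^{(\alpha,\beta)}$ the Jacobi polynomials, so that $G_{\ell;d}(1)=1$. $J_\nu$ is the Bessel function of the first kind of order $\nu$; $(\frac d2-1)!=\Gamma(\frac d2)$. The notation $o_{q;d}(1)$ denotes a quantity tending to $0$ as $\ell\to\infty$ for fixed $q,d$. *)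

theory Defs
  imports "HOL-Analysis.Analysis"
begin

(* Szego's explicit form; the factors are generalized binomial coefficients,
   since alpha and beta are real. *)
definition jacobi_P :: "real \<Rightarrow> real \<Rightarrow> nat \<Rightarrow> real \<Rightarrow> real" where
  "jacobi_P \<alpha> \<beta> n x =
     (\<Sum>s\<le>n. ((real n + \<alpha>) gchoose (n - s)) * ((real n + \<beta>) gchoose s)
             * ((x - 1) / 2) ^ s * ((x + 1) / 2) ^ (n - s))"

definition gegenbauer_G :: "nat \<Rightarrow> nat \<Rightarrow> real \<Rightarrow> real" where
  "gegenbauer_G l d x =
     jacobi_P (real d / 2 - 1) (real d / 2 - 1) l x / ((real l + real d / 2 - 1) gchoose l)"

(* Bessel function of the first kind, by its power series, for x > 0.
   The reciprocal Gamma function vanishes at the poles of Gamma. *)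
definition bessel_J :: "real \<Rightarrow> real \<Rightarrow> real" where
  "bessel_J \<nu> x =
     (x / 2) powr \<nu> * (\<Sum>k. (- 1) ^ k * rGamma (real k + \<nu> + 1) / fact k * (x / 2) ^ (2 * k))"

definition c_integrand :: "nat \<Rightarrow> nat \<Rightarrow> real \<Rightarrow> real" where
  "c_integrand q d \<psi> =
     bessel_J (real d / 2 - 1) \<psi> ^ q * \<psi> powr (- real q * (real d / 2 - 1) + real d - 1)"

(* The Henstock-Kurzweil integral over the half-line is the improper integral, i.e. the limit of
   the integrals over {0..R} as R tends to infinity; it need not converge absolutely.
   Gamma (d / 2) is the factorial of d / 2 - 1.  The value of the integrand at 0 is irrelevant. *)
definition c_const :: "nat \<Rightarrow> nat \<Rightarrow> real" where
  "c_const q d =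
     (2 powr (real d / 2 - 1) * Gamma (real d / 2)) ^ q * integral {0..} (c_integrand q d)"

lemma gegenbauer_G_1: "d > 0 \<Longrightarrow> gegenbauer_G l d 1 = 1"
proof -
  assume d: "d > 0"
  have eq: "jacobi_P a a l 1 = (real l + a) gchoose l" for a
  proof -
    have "jacobi_P a a l 1 = (\<Sum>s\<le>l. if s = 0 then (real l + a) gchoose l else 0)"
      unfolding jacobi_P_def by (intro sum.cong) auto
    then show ?thesis by simp
  qed
  have "(real l + (real d / 2 - 1)) gchoose l \<noteq> 0"
    using d by (auto simp: gbinomial_prod_rev prod_zero_iff)
  then show ?thesis
    by (simp add: gegenbauer_G_def eq add_diff_eq)
qed

end

theory Submission
  imports Defs "HOL-Probability.Sinc_Integral"
begin

text \<open>
  After the substitution $\vartheta = \psi / \ell$ the integrand converges pointwise (Mehler--Heine) to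
  $j(\psi)^q \psi^{d-1}$, where $j(\psi)$ is $J_{d/2-1}(\psi) \psi^{1-d/2}$ normalised by $j(0) = 1$.
  Sonin's monotone energy for the Gegenbauer equation gives the uniform bound
  $G_{\ell;d}(\cos\vartheta)^2 \le C (\ell \sin\vartheta)^{1-d}$, so dominated convergence applies
  unless $d = q = 3$. In that case $G_{\ell;3}(\cos\vartheta) = \sin((\ell+1)\vartheta) / ((\ell+1)\sin\vartheta)$
  and everything reduces to Dirichlet integrals.

  A relative error $1 + o(1)$ also requires $c_{q;d} \neq 0$, which is not obvious for odd $q$.
  Up to a positive constant, $c_{q;d}$ is the density at the origin of a random walk with $q$ independent uniform
  unit steps in $d$-dimensional space, and it is positive because for $q \ge 3$ there are closed equilateral
  $q$-gons whose sides are not all parallel. After Gaussian regularisation, the product formula for $j$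
  turns this into a recursion for the walk, in which the contribution near a closed
  polygon is bounded below step by step.
\<close>

subsection \<open>The Gegenbauer differential equation\<close>

text \<open>The decay bound makes the rescaled integrand O(psi^(-(q/2 - 1)(d - 1))) uniformly in the
  degree. The exponent is 1 exactly for d = q = 3 and at least 3/2 for every other admissible pair,
  which is why a single pair needs separate treatment. Every bound on j, and the formula j(psi) =
  sin psi / psi for d = 3, is inherited from the Gegenbauer polynomials through the Mehler-Heine
  limit.

  The walk is treated in radial terms only. By the law of cosines a unit step from distance a leads
  to distance sqrt(a^2 + 1 - 2 a cos phi), and the angle phi has density proportional to sin^(d-2)
  phi. The lower bound has to survive the removal of the Gaussian: rescaling by sigma contributes a
  factor sigma^d, so the regularised walk must be bounded below by a multiple of delta^d with delta
  = 1 / sigma, the order of the volume of a ball of radius delta. This fixes how many powers of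
  delta the steps may lose altogether.\<close>

definition gegenbauer_coeff :: "nat \<Rightarrow> real \<Rightarrow> nat \<Rightarrow> real" where
  "gegenbauer_coeff n a s = (\<Prod>i<s. ((real n - real i) * (real n + a - real i)) / ((real i + 1) * (a + 1 + real i)))"

lemma gegenbauer_coeff_0 [simp]: "gegenbauer_coeff n a 0 = 1"
  by (simp add: gegenbauer_coeff_def)

lemma gegenbauer_coeff_Suc: "gegenbauer_coeff n a (Suc s) = gegenbauer_coeff n a s * (((real n - real s) * (real n + a - real s)) / ((real s + 1) * (a + 1 + real s)))"
  by (simp add: gegenbauer_coeff_def)

lemma gegenbauer_coeff_eq_0: "s > n \<Longrightarrow> gegenbauer_coeff n a s = 0"
  unfolding gegenbauer_coeff_def by (intro prod_zero) (auto intro!: bexI[of _ n])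

text \<open>Raising s lowers one binomial index and raises the other, so neighbouring products have
  a rational quotient. \<open>gegenbauer_coeff\<close> multiplies these quotients up; in Pochhammer
  notation it is (-n)_s (-n-a)_s / (s! (a+1)_s). The condition a > -1 keeps the denominators
  nonzero.\<close>

lemma gbinomial_ratio:
  assumes "a > -1" "s \<le> n"
  shows "((real n + a) gchoose (n - s)) * ((real n + a) gchoose s) = gegenbauer_coeff n a s * ((real n + a) gchoose n)"
  using assms(2)
proof (induction s)
  case (Suc s)
  let ?b = "real n + a"
  obtain m where m: "n - s = Suc m" "n - Suc s = m" "real m = real n - real s - 1"
    using Suc.prems by (metis Suc_diff_Suc Suc_le_lessD diff_Suc_1' of_nat_Suc of_nat_diff add_diff_cancel_left' less_imp_le plus_1_eq_Suc)
  \<comment> \<open>Since m = n - s - 1, the factor n + a - m is a + 1 + s.\<close>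
  have 1: "(?b gchoose Suc m) * (real n - real s) = (?b gchoose m) * (a + 1 + real s)"
    using gbinomial_absorption'[of "Suc m" ?b] gbinomial_absorb_comp[of ?b m] gbinomial_absorption[of m ?b] m(3)
    by (simp add: algebra_simps)
  have 2: "(?b gchoose Suc s) * (real s + 1) = (?b gchoose s) * (?b - real s)"
    using gbinomial_absorb_comp[of ?b s] gbinomial_absorption[of s ?b]
    by (simp add: algebra_simps)
  have nz: "a + 1 + real s \<noteq> 0" "real s + 1 \<noteq> 0" using assms(1) by linarith+
  have e1: "(?b gchoose m) = (?b gchoose Suc m) * (real n - real s) / (a + 1 + real s)"
    using 1 nz by (simp add: field_simps)
  have e2: "(?b gchoose Suc s) = (?b gchoose s) * (?b - real s) / (real s + 1)"
    using 2 nz by (simp add: field_simps)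
  have IH: "(?b gchoose Suc m) * (?b gchoose s) = gegenbauer_coeff n a s * (?b gchoose n)"
    using Suc m by simp
  have "(?b gchoose (n - Suc s)) * (?b gchoose Suc s) = ((?b gchoose Suc m) * (?b gchoose s)) * ((real n - real s) * (?b - real s) / ((real s + 1) * (a + 1 + real s)))"
    unfolding m(2) e1 e2 by (simp add: mult_ac)
  also have "\<dots> = gegenbauer_coeff n a (Suc s) * (?b gchoose n)"
    unfolding IH gegenbauer_coeff_Suc by simp
  finally show ?case .
qed simp

lemma gegenbauer_G_altdef:
  assumes "d > 0"
  shows "gegenbauer_G n d x =
    (\<Sum>s\<le>n. gegenbauer_coeff n (real d / 2 - 1) s * ((x - 1) / 2) ^ s * ((x + 1) / 2) ^ (n - s))"
proof -
  define a where "a = real d / 2 - 1"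
  have a: "a > -1" using assms by (simp add: a_def)
  have nz: "((real n + a) gchoose n) \<noteq> 0"
    using a by (auto simp: gbinomial_prod_rev prod_zero_iff)
  have "jacobi_P a a n x = ((real n + a) gchoose n) * (\<Sum>s\<le>n. gegenbauer_coeff n a s * ((x - 1) / 2) ^ s * ((x + 1) / 2) ^ (n - s))"
    unfolding jacobi_P_def sum_distrib_left
    by (intro sum.cong refl) (simp only: gbinomial_ratio[OF a] atMost_iff, simp add: mult_ac)
  then show ?thesis
    using nz by (simp add: gegenbauer_G_def a_def[symmetric] add_diff_eq[symmetric])
qed

text \<open>
  Since $v - u = 1$, the Gegenbauer operator maps the monomial $u^s v^{n-s}$ to differences of neighbouring
  monomials of the same degree; weighted with the coefficients these telescope over $s$.
\<close>

lemma jacobi_term_ode: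
  fixes u v x a :: real
  defines "u \<equiv> (x - 1) / 2" and "v \<equiv> (x + 1) / 2"
  assumes "s \<le> n"
  shows "(1 - x\<^sup>2) * ((real s * real (s - 1) * u ^ (s - 2) * v ^ (n - s)
             + 2 * real s * real (n - s) * u ^ (s - 1) * v ^ (n - s - 1)
             + real (n - s) * real (n - s - 1) * u ^ s * v ^ (n - s - 2)) / 4)
         - (2 * a + 2) * x * ((real s * u ^ (s - 1) * v ^ (n - s) + real (n - s) * u ^ s * v ^ (n - s - 1)) / 2)
         + real n * (real n + 2 * a + 1) * (u ^ s * v ^ (n - s))
       = real s * (real s + a) * (u ^ s * v ^ (n - s) - u ^ (s - 1) * v ^ (n - (s - 1)))
         - (real n - real s) * (real n - real s + a) * (u ^ (Suc s) * v ^ (n - Suc s) - u ^ s * v ^ (n - s))"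
proof -
  obtain m where n: "n = s + m" using assms(3) le_Suc_ex by blast
  have x: "x = u + v" "1 - x\<^sup>2 = - 4 * (u * v)" 
    by (simp_all add: u_def v_def field_simps power2_eq_square)
  \<comment> \<open>These abbreviations hide the truncated exponents s - 1, s - 2, m - 1, m - 2.
    Multiplied by u or v they obey relations that hold for small s and m too, and what remains is a
    polynomial identity.\<close>
  define A1 A2 B1 B2 U V where "A1 = real s * u ^ (s - 1)" "A2 = real s * real (s - 1) * u ^ (s - 2)"
    "B1 = real m * v ^ (m - 1)" "B2 = real m * real (m - 1) * v ^ (m - 2)" "U = u ^ s" "V = v ^ m"
  note defs = this
  have 1: "u * A1 = real s * U"
    unfolding defs by (cases s) auto
  have 2: "u * A2 = (real s - 1) * A1"
    unfolding defs by (cases s; cases "s - 1") auto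
  have 3: "v * B1 = real m * V"
    unfolding defs by (cases m) auto
  have 4: "v * B2 = (real m - 1) * B1"
    unfolding defs by (cases m; cases "m - 1") auto
  have 5: "real s * u ^ (s - 1) * v ^ (n - (s - 1)) = A1 * v * V"
    unfolding defs n by (cases s) auto
  have 6: "(real n - real s) * v ^ (n - Suc s) = B1"
    unfolding defs n by simp
  have L1: "(1 - x\<^sup>2) * ((real s * real (s - 1) * u ^ (s - 2) * v ^ (n - s)
             + 2 * real s * real (n - s) * u ^ (s - 1) * v ^ (n - s - 1)
             + real (n - s) * real (n - s - 1) * u ^ s * v ^ (n - s - 2)) / 4)
       = - ((u * A2) * v * V + 2 * (u * A1) * (v * B1) + u * U * (v * B2))"
    unfolding x(2) defs n by (simp add: field_simps)
  have L2: "x * ((real s * u ^ (s - 1) * v ^ (n - s) + real (n - s) * u ^ s * v ^ (n - s - 1)) / 2)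
       = ((u * A1) * V + A1 * v * V + u * U * B1 + U * (v * B1)) / 2"
    unfolding x(1) defs n by (simp add: algebra_simps add_divide_distrib)
  have R1: "real s * (real s + a) * (u ^ s * v ^ (n - s) - u ^ (s - 1) * v ^ (n - (s - 1)))
       = (real s + a) * (real s * U * V - A1 * v * V)"
    unfolding 5[symmetric] by (simp add: defs n algebra_simps)
  have R2: "(real n - real s) * (real n - real s + a) * (u ^ (Suc s) * v ^ (n - Suc s) - u ^ s * v ^ (n - s))
       = (real m + a) * (u * U * B1 - real m * U * V)"
    unfolding 6[symmetric] by (simp add: defs n algebra_simps)
  have L3: "u ^ s * v ^ (n - s) = U * V" by (simp add: defs n)
  have N: "real n = real s + real m" by (simp add: n)
  show ?thesis
    unfolding L1 R1 R2 mult.assoc[of "2 * a + 2"] L2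
    unfolding L3 1 2 3 4 N
    by (simp add: algebra_simps add_divide_distrib)
qed

lemma DERIV_power_mult_power_half:
  "((\<lambda>x::real. ((x - 1) / 2) ^ p * ((x + 1) / 2) ^ m) has_real_derivative
     (real p * ((x - 1) / 2) ^ (p - 1) * ((x + 1) / 2) ^ m + real m * ((x - 1) / 2) ^ p * ((x + 1) / 2) ^ (m - 1)) / 2) (at x)"
proof -
  have "((\<lambda>x::real. (x - 1) / 2) has_real_derivative 1 / 2) (at x)"
    "((\<lambda>x::real. (x + 1) / 2) has_real_derivative 1 / 2) (at x)"
    by (auto intro!: derivative_eq_intros)
  from DERIV_mult[OF DERIV_power[OF this(1), of p] DERIV_power[OF this(2), of m]]
  show ?thesis by (simp add: add_divide_distrib mult_ac)
qed

lemma gegenbauer_ode: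
  assumes "d > 0"
  obtains y1 y2 where
    "\<And>x. (gegenbauer_G n d has_real_derivative y1 x) (at x)"
    "\<And>x. (y1 has_real_derivative y2 x) (at x)"
    "\<And>x. (1 - x\<^sup>2) * y2 x - real d * x * y1 x + real n * (real n + real d - 1) * gegenbauer_G n d x = 0"
proof -
  define a where "a = real d / 2 - 1"
  have a: "a > -1" using assms by (simp add: a_def)
  define c where "c = gegenbauer_coeff n a"
  define y1 where "y1 = (\<lambda>x::real. \<Sum>s\<le>n. c s * ((real s * ((x - 1) / 2) ^ (s - 1) * ((x + 1) / 2) ^ (n - s)
     + real (n - s) * ((x - 1) / 2) ^ s * ((x + 1) / 2) ^ (n - s - 1)) / 2))"
  define y2 where "y2 = (\<lambda>x::real. \<Sum>s\<le>n. c s * ((real s * real (s - 1) * ((x - 1) / 2) ^ (s - 2) * ((x + 1) / 2) ^ (n - s)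
             + 2 * real s * real (n - s) * ((x - 1) / 2) ^ (s - 1) * ((x + 1) / 2) ^ (n - s - 1)
             + real (n - s) * real (n - s - 1) * ((x - 1) / 2) ^ s * ((x + 1) / 2) ^ (n - s - 2)) / 4))"
  have G: "gegenbauer_G n d = (\<lambda>x. \<Sum>s\<le>n. c s * (((x - 1) / 2) ^ s * ((x + 1) / 2) ^ (n - s)))"
    using gegenbauer_G_altdef[OF assms] by (auto simp: fun_eq_iff c_def a_def mult.assoc)
  have D1: "(gegenbauer_G n d has_real_derivative y1 x) (at x)" for x
    unfolding G y1_def by (intro DERIV_sum DERIV_cmult DERIV_power_mult_power_half)
  have D2: "(y1 has_real_derivative y2 x) (at x)" for x
  proof -
    have "((\<lambda>x. (real s * (((x - 1) / 2) ^ (s - 1) * ((x + 1) / 2) ^ (n - s))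
            + real (n - s) * (((x - 1) / 2) ^ s * ((x + 1) / 2) ^ (n - s - 1))) / 2) has_real_derivative
        ((real s * real (s - 1) * ((x - 1) / 2) ^ (s - 2) * ((x + 1) / 2) ^ (n - s)
             + 2 * real s * real (n - s) * ((x - 1) / 2) ^ (s - 1) * ((x + 1) / 2) ^ (n - s - 1)
             + real (n - s) * real (n - s - 1) * ((x - 1) / 2) ^ s * ((x + 1) / 2) ^ (n - s - 2)) / 4)) (at x)" for s
      using DERIV_cdivide[OF DERIV_add[OF
        DERIV_cmult[OF DERIV_power_mult_power_half[of "s - 1" "n - s" x], of "real s"]
        DERIV_cmult[OF DERIV_power_mult_power_half[of "s" "n - s - 1" x], of "real (n - s)"]], of 2]
      by (rule back_subst[of "\<lambda>z. (_ has_real_derivative z) (at x)"])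
         (simp add: add_divide_distrib distrib_left mult_ac numeral_2_eq_2)
    then show ?thesis
      unfolding y1_def y2_def by (intro DERIV_sum DERIV_cmult) (simp only: mult.assoc)
  qed
  have ode: "(1 - x\<^sup>2) * y2 x - real d * x * y1 x + real n * (real n + real d - 1) * gegenbauer_G n d x = 0" for x
  proof -
    define u v where "u = (x - 1) / 2" "v = (x + 1) / 2"
    \<comment> \<open>\<open>f s\<close> is the first half of \<open>jacobi_term_ode\<close> times
      the coefficient; by \<open>c_Suc\<close> the second half is \<open>f (Suc s)\<close>. Both
      ends of the telescope vanish: \<open>f 0\<close> by its factor s, \<open>f (Suc n)\<close>
      because the coefficient is 0 beyond n.\<close>
    define f where "f = (\<lambda>s. real s * (real s + a) * c s * (u ^ s * v ^ (n - s) - u ^ (s - 1) * v ^ (n - (s - 1))))"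
    have d: "real d = 2 * a + 2" by (simp add: a_def)
    have c_Suc: "real (Suc s) * (real (Suc s) + a) * c (Suc s) = (real n - real s) * (real n - real s + a) * c s" for s
    proof -
      define P where "P = (real s + 1) * (a + 1 + real s)"
      have "P \<noteq> 0" using a by (simp add: P_def)
      moreover have "real (Suc s) * (real (Suc s) + a) = P" by (simp add: P_def algebra_simps)
      ultimately have "real (Suc s) * (real (Suc s) + a) * c (Suc s) = gegenbauer_coeff n a s * ((real n - real s) * (real n + a - real s))"
        unfolding c_def gegenbauer_coeff_Suc P_def[symmetric] by simp
      then show ?thesis by (simp add: c_def algebra_simps)
    qed
    have "(1 - x\<^sup>2) * y2 x - real d * x * y1 x + real n * (real n + real d - 1) * gegenbauer_G n d x
      = (\<Sum>s\<le>n. c s * ((1 - x\<^sup>2) * ((real s * real (s - 1) * u ^ (s - 2) * v ^ (n - s)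
             + 2 * real s * real (n - s) * u ^ (s - 1) * v ^ (n - s - 1)
             + real (n - s) * real (n - s - 1) * u ^ s * v ^ (n - s - 2)) / 4)
         - (2 * a + 2) * x * ((real s * u ^ (s - 1) * v ^ (n - s) + real (n - s) * u ^ s * v ^ (n - s - 1)) / 2)
         + real n * (real n + 2 * a + 1) * (u ^ s * v ^ (n - s))))"
      unfolding G y1_def y2_def sum_distrib_left sum_subtractf[symmetric] sum.distrib[symmetric] d u_v_def
      by (intro sum.cong refl) (simp add: algebra_simps)
    also have "\<dots> = (\<Sum>s\<le>n. f s - f (Suc s))"
    proof (intro sum.cong refl)
      fix s assume "s \<in> {..n}"
      then have s: "s \<le> n" by simp
      show "c s * ((1 - x\<^sup>2) * ((real s * real (s - 1) * u ^ (s - 2) * v ^ (n - s)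
             + 2 * real s * real (n - s) * u ^ (s - 1) * v ^ (n - s - 1)
             + real (n - s) * real (n - s - 1) * u ^ s * v ^ (n - s - 2)) / 4)
         - (2 * a + 2) * x * ((real s * u ^ (s - 1) * v ^ (n - s) + real (n - s) * u ^ s * v ^ (n - s - 1)) / 2)
         + real n * (real n + 2 * a + 1) * (u ^ s * v ^ (n - s))) = f s - f (Suc s)"
        unfolding u_v_def jacobi_term_ode[OF s] f_def c_Suc
        by (simp add: algebra_simps)
    qed
    also have "\<dots> = f 0 - f (Suc n)" by (rule sum_telescope)
    also have "\<dots> = 0" by (simp add: f_def c_def gegenbauer_coeff_eq_0)
    finally show ?thesis .
  qed
  show ?thesis using that D1 D2 ode by blast
qed

section \<open>Energy estimates in the angle variable\<close>

lemma DERIV_nonpos_imp_endpoint_le: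
  fixes f f' :: "real \<Rightarrow> real"
  assumes "a \<le> b" "\<And>x. a \<le> x \<Longrightarrow> x \<le> b \<Longrightarrow> (f has_real_derivative f' x) (at x)"
    "\<And>x. a \<le> x \<Longrightarrow> x \<le> b \<Longrightarrow> f' x \<le> 0"
  shows "f b \<le> f a"
  by (rule DERIV_nonpos_imp_nonincreasing[OF assms(1)]) (use assms(2,3) in blast)

text \<open>
  The bounds come from the energy $n (n+d-1) g^2 + g'^2$, which is decreasing on $[0, \pi/2]$.
\<close>

lemma gegenbauer_theta:
  assumes "d \<ge> 1" "n > 0"
  obtains g1 where
    "\<And>\<theta>. ((\<lambda>\<theta>. gegenbauer_G n d (cos \<theta>)) has_real_derivative g1 \<theta>) (at \<theta>)"
    "\<And>\<theta>. sin \<theta> \<noteq> 0 \<Longrightarrow> (g1 has_real_derivative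
        - ((real d - 1) * (cos \<theta> / sin \<theta>)) * g1 \<theta> - real n * (real n + real d - 1) * gegenbauer_G n d (cos \<theta>)) (at \<theta>)"
    "\<And>\<theta>. 0 \<le> \<theta> \<Longrightarrow> \<theta> \<le> pi / 2 \<Longrightarrow> \<bar>gegenbauer_G n d (cos \<theta>)\<bar> \<le> 1"
    "\<And>\<theta>. 0 \<le> \<theta> \<Longrightarrow> \<theta> \<le> pi / 2 \<Longrightarrow> (g1 \<theta>)\<^sup>2 \<le> real n * (real n + real d - 1)"
    "g1 0 = 0"
proof -
  have "d > 0" using assms by simp
  obtain y1 y2 where y: "\<And>x. (gegenbauer_G n d has_real_derivative y1 x) (at x)"
    "\<And>x. (y1 has_real_derivative y2 x) (at x)"
    "\<And>x. (1 - x\<^sup>2) * y2 x - real d * x * y1 x + real n * (real n + real d - 1) * gegenbauer_G n d x = 0"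
    using gegenbauer_ode[OF \<open>d > 0\<close>, of n] by blast
  define K where "K = real n * (real n + real d - 1)"
  have K: "K > 0" unfolding K_def using assms by (intro mult_pos_pos) auto
  define g where "g = (\<lambda>\<theta>. gegenbauer_G n d (cos \<theta>))"
  define g1 where "g1 = (\<lambda>\<theta>. - sin \<theta> * y1 (cos \<theta>))"
  have D1: "(g has_real_derivative g1 \<theta>) (at \<theta>)" for \<theta>
    unfolding g_def g1_def
    using DERIV_chain2[OF y(1) DERIV_cos] by (simp add: mult.commute)
  have D2: "(g1 has_real_derivative (real d - 1) * cos \<theta> * y1 (cos \<theta>) - K * g \<theta>) (at \<theta>)" for \<theta>
  proof -
    have "(g1 has_real_derivative (- cos \<theta> * y1 (cos \<theta>) + (- sin \<theta>) * (y2 (cos \<theta>) * (- sin \<theta>)))) (at \<theta>)"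
      unfolding g1_def
      by (rule derivative_eq_intros DERIV_chain2[OF y(2)] refl | simp)+
    moreover have "(1 - (cos \<theta>)\<^sup>2) = (sin \<theta>)\<^sup>2" by (simp add: sin_squared_eq)
    then have "(sin \<theta>)\<^sup>2 * y2 (cos \<theta>) = real d * cos \<theta> * y1 (cos \<theta>) - K * g \<theta>"
      using y(3)[of "cos \<theta>"] unfolding K_def g_def by simp
    then have "(- cos \<theta> * y1 (cos \<theta>) + (- sin \<theta>) * (y2 (cos \<theta>) * (- sin \<theta>))) = (real d - 1) * cos \<theta> * y1 (cos \<theta>) - K * g \<theta>"
      by (simp add: power2_eq_square algebra_simps)
    ultimately show ?thesis by simp
  qed
  have E: "K * (g \<theta>)\<^sup>2 + (g1 \<theta>)\<^sup>2 \<le> K" if "0 \<le> \<theta>" "\<theta> \<le> pi / 2" for \<theta>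
  proof -
    have "K * (g \<theta>)\<^sup>2 + (g1 \<theta>)\<^sup>2 \<le> K * (g 0)\<^sup>2 + (g1 0)\<^sup>2"
    proof (rule DERIV_nonpos_imp_endpoint_le[where f = "\<lambda>\<theta>. K * (g \<theta>)\<^sup>2 + (g1 \<theta>)\<^sup>2"])
      fix t assume t: "0 \<le> t" "t \<le> \<theta>"
      \<comment> \<open>The derivative is -2 (d - 1) cot t times the square of g1; substituting g1 =
        - sin t y1 (cos t) removes the cotangent, which is singular at t = 0.\<close>
      show "((\<lambda>\<theta>. K * (g \<theta>)\<^sup>2 + (g1 \<theta>)\<^sup>2) has_real_derivative
          - 2 * (real d - 1) * (cos t * sin t * (y1 (cos t))\<^sup>2)) (at t)"
        by (rule derivative_eq_intros D1 D2 refl | simp add: g1_def power2_eq_square algebra_simps)+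
      have "0 \<le> cos t" "0 \<le> sin t" using t that by (auto intro!: cos_ge_zero sin_ge_zero)
      then show "- 2 * (real d - 1) * (cos t * sin t * (y1 (cos t))\<^sup>2) \<le> 0"
        using assms by (simp add: mult_le_0_iff)
    qed (use that in auto)
    then show ?thesis using gegenbauer_G_1[OF \<open>d > 0\<close>] by (simp add: g_def g1_def)
  qed
  show thesis
  proof (rule that[of g1])
    fix \<theta> :: real
    show "((\<lambda>\<theta>. gegenbauer_G n d (cos \<theta>)) has_real_derivative g1 \<theta>) (at \<theta>)" 
      using D1[of \<theta>] by (simp add: g_def)
    assume "sin \<theta> \<noteq> 0"
    then show "(g1 has_real_derivative
        - ((real d - 1) * (cos \<theta> / sin \<theta>)) * g1 \<theta> - real n * (real n + real d - 1) * gegenbauer_G n d (cos \<theta>)) (at \<theta>)"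
      using D2[of \<theta>] by (simp add: K_def[symmetric] g_def g1_def mult.assoc)
  next
    fix \<theta> :: real assume t: "0 \<le> \<theta>" "\<theta> \<le> pi / 2"
    have "K * (g \<theta>)\<^sup>2 \<le> K * 1" using E[OF t] zero_le_power2[of "g1 \<theta>"] by linarith
    then have "(g \<theta>)\<^sup>2 \<le> 1" using K by (simp only: mult_le_cancel_left_pos)
    then show "\<bar>gegenbauer_G n d (cos \<theta>)\<bar> \<le> 1" by (simp add: g_def abs_square_le_1)
    have "0 \<le> K * (g \<theta>)\<^sup>2" using K by simp
    then show "(g1 \<theta>)\<^sup>2 \<le> real n * (real n + real d - 1)" using E[OF t] unfolding K_def[symmetric] by linarith
  qed (simp add: g1_def)
qed

text \<open>
  With $\lambda = (d-1)/2$, $L = n + \lambda$, $\varphi = L^2 - \lambda(\lambda-1)/\sin^2\vartheta$ and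
  $v = g' + \lambda \cot\vartheta\, g$, the quantity $\sin^{2\lambda}\vartheta\,(g^2 + v^2/\varphi)$ has derivative
  $-\sin^{2\lambda}\vartheta\; v^2 \varphi'/\varphi^2 \le 0$ as long as $\varphi > 0$. It is compared with its value at
  the angle where $L \sin\vartheta = d - 1$; below that angle $|g| \le 1$ suffices.
\<close>

lemma gegenbauer_decay:
  assumes "d \<ge> 3" "n > 0" "0 < \<theta>" "\<theta> \<le> pi / 2"
  shows "(real n * sin \<theta>) ^ (d - 1) * (gegenbauer_G n d (cos \<theta>))\<^sup>2 \<le> 4 * (real d - 1) ^ (d - 1)"
proof -
  define D where "D = d - 1"
  have D: "real D = real d - 1" "D \<ge> 2" using assms by (auto simp: D_def)
  define lam where "lam = (real d - 1) / 2"
  have lam: "lam \<ge> 1" "2 * lam = real D" "real d - 1 = 2 * lam" using assms D by (auto simp: lam_def)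
  define L where "L = real n + lam"
  have L: "L > 0" "real n \<le> L" using lam by (auto simp: L_def)
  define g where "g = (\<lambda>\<theta>. gegenbauer_G n d (cos \<theta>))"
  have "d \<ge> 1" using assms by simp
  obtain g1 where g1: 
    "\<And>\<theta>. (g has_real_derivative g1 \<theta>) (at \<theta>)"
    "\<And>\<theta>. sin \<theta> \<noteq> 0 \<Longrightarrow> (g1 has_real_derivative
        - (2 * lam * (cos \<theta> / sin \<theta>)) * g1 \<theta> - real n * (real n + 2 * lam) * g \<theta>) (at \<theta>)"
    "\<And>\<theta>. 0 \<le> \<theta> \<Longrightarrow> \<theta> \<le> pi / 2 \<Longrightarrow> \<bar>g \<theta>\<bar> \<le> 1"
    "\<And>\<theta>. 0 \<le> \<theta> \<Longrightarrow> \<theta> \<le> pi / 2 \<Longrightarrow> (g1 \<theta>)\<^sup>2 \<le> real n * (real n + 2 * lam)"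
    using gegenbauer_theta[OF \<open>d \<ge> 1\<close> assms(2)] unfolding g_def lam(3)[symmetric] add_diff_eq by metis
  have g_sq: "(g t)\<^sup>2 \<le> 1" if "0 \<le> t" "t \<le> pi / 2" for t
    using g1(3)[OF that] by (simp add: abs_square_le_1)
  have "(L * sin \<theta>) ^ D * (g \<theta>)\<^sup>2 \<le> 4 * real D ^ D"
  proof (cases "L * sin \<theta> \<le> real D")
    case True
    have "0 \<le> L * sin \<theta>" using L assms by (auto intro!: mult_nonneg_nonneg sin_ge_zero)
    then have "(L * sin \<theta>) ^ D * (g \<theta>)\<^sup>2 \<le> real D ^ D * 1"
      using True g_sq[of \<theta>] assms by (intro mult_mono power_mono) auto
    also have "\<dots> \<le> 4 * real D ^ D" by simp
    finally show ?thesis .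
  next
    case False
    define t0 where "t0 = arcsin (real D / L)"
    have "sin \<theta> \<le> 1" by simp
    then have "L * sin \<theta> \<le> L" using L by (simp add: mult_le_cancel_left1)
    then have "real D \<le> L" using False by linarith
    then have DL: "0 < real D / L" "real D / L \<le> 1" "real D / L < sin \<theta>" using False L D by (auto simp: field_simps)
    have t0: "0 < t0" "t0 \<le> pi / 2" "sin t0 = real D / L"
      using DL arcsin_less_mono[of 0 "real D / L"] arcsin_le_mono[of "real D / L" 1] by (auto simp: t0_def)
    have "t0 \<le> \<theta>"
    proof (rule ccontr)
      assume "\<not> t0 \<le> \<theta>"
      then have "sin \<theta> \<le> sin t0" using assms t0 by (intro sin_monotone_2pi_le) auto
      then show False using t0(3) DL by simp
    qed
    define \<phi> where "\<phi> = (\<lambda>t. L\<^sup>2 - lam * (lam - 1) / (sin t)\<^sup>2)"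
    \<comment> \<open>The function w = sin^lam g is the Liouville normal form: w'' + phi w = 0 and
      w' = sin^lam v. The monitored quantity is thus Sonin's w^2 + w'^2 / phi.\<close>
    define v where "v = (\<lambda>t. g1 t + lam * (cos t / sin t) * g t)"
    \<comment> \<open>Here L sin t >= d - 1 = 2 lam, so the singular term of phi is at most lam^2 /
      sin^2 t <= L^2 / 4. The threshold d - 1 is chosen for this.\<close>
    have pos: "sin t \<ge> real D / L" "cos t \<ge> 0" "\<phi> t \<ge> 3 / 4 * L\<^sup>2" "\<phi> t > 0" "sin t > 0" if "t0 \<le> t" "t \<le> \<theta>" for t
    proof -
      show s: "sin t \<ge> real D / L" unfolding t0(3)[symmetric] using that assms t0 by (intro sin_monotone_2pi_le) auto
      then show s0: "sin t > 0" using DL by linarith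
      show "cos t \<ge> 0" using that t0 assms by (intro cos_ge_zero) auto
      have "L * sin t \<ge> 2 * lam" using s L lam by (simp add: field_simps)
      then have "(2 * lam)\<^sup>2 \<le> (L * sin t)\<^sup>2" using lam by (intro power_mono) auto
      then have "lam\<^sup>2 / (sin t)\<^sup>2 \<le> L\<^sup>2 / 4" using s0 by (simp add: field_simps power_mult_distrib)
      moreover have "lam * (lam - 1) / (sin t)\<^sup>2 \<le> lam\<^sup>2 / (sin t)\<^sup>2"
        using lam by (intro divide_right_mono) (auto simp: power2_eq_square algebra_simps)
      ultimately show "\<phi> t \<ge> 3 / 4 * L\<^sup>2" unfolding \<phi>_def by linarith
      moreover have "L\<^sup>2 > 0" using L by simp
      ultimately show "\<phi> t > 0" by linarith
    qed
    have "sin \<theta> ^ D * ((g \<theta>)\<^sup>2 + (v \<theta>)\<^sup>2 / \<phi> \<theta>) \<le> sin t0 ^ D * ((g t0)\<^sup>2 + (v t0)\<^sup>2 / \<phi> t0)"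
    proof (rule DERIV_nonpos_imp_endpoint_le[where f = "\<lambda>t. sin t ^ D * ((g t)\<^sup>2 + (v t)\<^sup>2 / \<phi> t)"])
      show "t0 \<le> \<theta>" by fact
      fix t assume t: "t0 \<le> t" "t \<le> \<theta>"
      note p = pos[OF t]
      define c s where "c = cos t" and "s = sin t"
      have s: "s > 0" "s \<noteq> 0" "c \<ge> 0" using p by (auto simp: s_def c_def)
      have cs: "c * c = 1 - s * s" unfolding c_def s_def by (metis add_diff_cancel_left' sin_cos_squared_add power2_eq_square)
      define \<phi>' where "\<phi>' = 2 * lam * (lam - 1) * c / s ^ 3"
      have d\<phi>: "(\<phi> has_real_derivative \<phi>') (at t)"
        unfolding \<phi>_def \<phi>'_def c_def s_def using s(2)[unfolded s_def]
        by (auto intro!: derivative_eq_intros simp: field_simps power2_eq_square power3_eq_cube power4_eq_xxxx)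
      have dg: "(g has_real_derivative v t - lam * (c / s) * g t) (at t)"
        using g1(1)[of t] by (simp add: v_def c_def s_def)
      have dcot: "((\<lambda>t. cos t / sin t) has_real_derivative - 1 / s\<^sup>2) (at t)"
      proof -
        have "- sin t * sin t - cos t * cos t = - 1" using cs by (simp add: c_def s_def)
        with DERIV_divide[OF DERIV_cos DERIV_sin, of t] s show ?thesis by (simp add: s_def power2_eq_square)
      qed
      have "real n * (real n + 2 * lam) = L\<^sup>2 - lam\<^sup>2" by (simp add: L_def power2_eq_square algebra_simps)
      then have dg1: "(g1 has_real_derivative - (2 * lam * (c / s)) * g1 t - (L\<^sup>2 - lam\<^sup>2) * g t) (at t)"
        using g1(2)[of t] s unfolding c_def s_def by simp
      have "(v has_real_derivative - (2 * lam * (c / s)) * g1 t - (L\<^sup>2 - lam\<^sup>2) * g t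
           + (lam * (- 1 / s\<^sup>2) * g t + (g1 t) * (lam * (c / s)))) (at t)"
        unfolding v_def c_def s_def
        by (rule DERIV_add dg1[unfolded c_def s_def] DERIV_mult DERIV_cmult dcot[unfolded s_def] g1(1))+
      also have "- (2 * lam * (c / s)) * g1 t - (L\<^sup>2 - lam\<^sup>2) * g t + (lam * (- 1 / s\<^sup>2) * g t + (g1 t) * (lam * (c / s)))
         = - lam * (c / s) * v t + g t * (lam\<^sup>2 * ((c * c) / s\<^sup>2) - (L\<^sup>2 - lam\<^sup>2) - lam / s\<^sup>2)"
        by (simp add: v_def c_def[symmetric] s_def[symmetric] algebra_simps power2_eq_square)
      also have "lam\<^sup>2 * ((c * c) / s\<^sup>2) - (L\<^sup>2 - lam\<^sup>2) - lam / s\<^sup>2 = - \<phi> t"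
        unfolding cs \<phi>_def s_def[symmetric] using s by (simp add: field_simps power2_eq_square)
      finally have dv: "(v has_real_derivative - lam * (c / s) * v t - \<phi> t * g t) (at t)" by (simp add: mult.commute)
      have ds: "((\<lambda>t. sin t ^ D) has_real_derivative 2 * lam * (c / s) * s ^ D) (at t)"
      proof -
        have "((\<lambda>t. sin t ^ D) has_real_derivative real D * (cos t * sin t ^ (D - 1))) (at t)"
          using DERIV_power[OF DERIV_sin, of D t] by simp
        moreover have "s ^ D = s * s ^ (D - 1)" using D by (cases D) auto
        ultimately show ?thesis unfolding lam(2) using s by (simp add: c_def s_def)
      qed
      have nz: "\<phi> t \<noteq> 0" using p by simp
      define G V F r S where "G = g t" "V = v t" "F = \<phi> t" "r = lam * (c / s)" "S = s ^ D"
      note defs = this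
      have "((\<lambda>t. sin t ^ D * ((g t)\<^sup>2 + (v t)\<^sup>2 / \<phi> t)) has_real_derivative
         2 * r * S * (G\<^sup>2 + V\<^sup>2 / F) + (2 * (V - r * G) * G + ((2 * (- r * V - F * G) * V) * F - V\<^sup>2 * \<phi>') / (F * F)) * S) (at t)"
        using DERIV_mult[OF ds DERIV_add[OF DERIV_power[OF dg, of 2] DERIV_divide[OF DERIV_power[OF dv, of 2] d\<phi> nz]]]
        by (simp add: defs s_def[symmetric] mult_ac)
      also have "2 * r * S * (G\<^sup>2 + V\<^sup>2 / F) + (2 * (V - r * G) * G + ((2 * (- r * V - F * G) * V) * F - V\<^sup>2 * \<phi>') / (F * F)) * S
         = - (S * V\<^sup>2 * \<phi>' / (F * F))"
        using nz by (simp add: defs(3) divide_simps) (simp add: algebra_simps power2_eq_square)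
      finally show "((\<lambda>t. sin t ^ D * ((g t)\<^sup>2 + (v t)\<^sup>2 / \<phi> t)) has_real_derivative - (s ^ D * (v t)\<^sup>2 * \<phi>' / (\<phi> t * \<phi> t))) (at t)"
        by (simp add: defs)
      have "\<phi>' \<ge> 0" unfolding \<phi>'_def using s lam by (intro divide_nonneg_nonneg mult_nonneg_nonneg) auto
      then show "- (s ^ D * (v t)\<^sup>2 * \<phi>' / (\<phi> t * \<phi> t)) \<le> 0" using s by simp
    qed
    \<comment> \<open>From n (n + 2 lam) <= L^2 follows |g1| <= L, and sin t0 = 2 lam / L gives |lam
      cot t0| <= L / 2. Hence v^2 <= 9/4 L^2 = 3 * (3/4 L^2) <= 3 phi; adding g^2 <= 1 produces the
      constant 4 of the lemma.\<close>
    moreover have "(v t0)\<^sup>2 / \<phi> t0 \<le> 3"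
    proof -
      have s: "sin t0 > 0" "\<phi> t0 \<ge> 3 / 4 * L\<^sup>2" using pos[of t0] \<open>t0 \<le> \<theta>\<close> by auto
      have "(g1 t0)\<^sup>2 \<le> L\<^sup>2"
        using g1(4)[of t0] t0 by (simp add: L_def power2_eq_square algebra_simps) (smt (verit) mult_nonneg_nonneg lam(1))
      then have 1: "\<bar>g1 t0\<bar> \<le> L" using L by (simp add: abs_le_square_iff[symmetric])
      have "lam * (cos t0 / sin t0) = cos t0 * L / 2"
        unfolding t0(3) lam(2)[symmetric] using lam(1) by simp
      also have "\<bar>\<dots>\<bar> \<le> L / 2" using abs_cos_le_one[of t0] L by (simp add: abs_mult mult_le_cancel_right2 del: abs_cos_le_one)
      finally have 2: "\<bar>lam * (cos t0 / sin t0)\<bar> \<le> L / 2" .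
      have "\<bar>lam * (cos t0 / sin t0) * g t0\<bar> \<le> L / 2 * 1"
        unfolding abs_mult[of _ "g t0"] using 2 g1(3)[of t0] t0 L by (intro mult_mono) auto
      then have "\<bar>v t0\<bar> \<le> 3 / 2 * L"
        unfolding v_def by (intro order_trans[OF abs_triangle_ineq]) (use 1 in argo)
      then have "(v t0)\<^sup>2 \<le> (3 / 2 * L)\<^sup>2" by (metis abs_ge_zero power2_abs power_mono)
      also have "\<dots> \<le> 3 * \<phi> t0" using s by (simp add: power2_eq_square)
      finally show ?thesis using pos(4)[of t0] \<open>t0 \<le> \<theta>\<close> by (simp add: field_simps)
    qed
    then have "(g t0)\<^sup>2 + (v t0)\<^sup>2 / \<phi> t0 \<le> 4" using g_sq[of t0] t0 by simp
    then have "sin t0 ^ D * ((g t0)\<^sup>2 + (v t0)\<^sup>2 / \<phi> t0) \<le> sin t0 ^ D * 4"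
      using pos[of t0] \<open>t0 \<le> \<theta>\<close> by (intro mult_left_mono) auto
    moreover have "sin \<theta> ^ D * (g \<theta>)\<^sup>2 \<le> sin \<theta> ^ D * ((g \<theta>)\<^sup>2 + (v \<theta>)\<^sup>2 / \<phi> \<theta>)"
      using pos[of \<theta>] \<open>t0 \<le> \<theta>\<close> by (intro mult_left_mono) auto
    ultimately have "sin \<theta> ^ D * (g \<theta>)\<^sup>2 \<le> (real D / L) ^ D * 4" using t0(3) by simp
    then have "L ^ D * (sin \<theta> ^ D * (g \<theta>)\<^sup>2) \<le> L ^ D * ((real D / L) ^ D * 4)"
      using L by (intro mult_left_mono) auto
    then show ?thesis using L by (simp add: power_mult_distrib power_divide mult_ac)
  qed
  moreover have "(real n * sin \<theta>) ^ D * (g \<theta>)\<^sup>2 \<le> (L * sin \<theta>) ^ D * (g \<theta>)\<^sup>2"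
    using L assms by (intro mult_right_mono power_mono mult_nonneg_nonneg sin_ge_zero) auto
  ultimately show ?thesis unfolding D_def[symmetric] D(1)[symmetric] g_def by linarith
qed

subsection \<open>The Mehler--Heine limit\<close>

text \<open>
  The argument of \<open>bessel_series\<close> is the square of that of the Bessel function:
  $j(\psi)$ is \<open>bessel_series d (\<psi>\<^sup>2)\<close>.
\<close>

definition bessel_coeff :: "nat \<Rightarrow> nat \<Rightarrow> real" where
  "bessel_coeff d k = (\<Prod>i<k. - 1 / (4 * (real i + 1) * (real d / 2 + real i)))"

definition bessel_series :: "nat \<Rightarrow> real \<Rightarrow> real" where
  "bessel_series d t = (\<Sum>k. bessel_coeff d k * t ^ k)"

text \<open>\<open>bessel_series d\<close> is the hypergeometric series 0F1(; d/2; -t/4). The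
  product form serves recursions; the closed form exposes the Pochhammer symbol that cancels against
  Gamma values and Gaussian moments.\<close>

lemma bessel_coeff_altdef:
  assumes "d > 0"
  shows "bessel_coeff d k = (- 1 / 4) ^ k / (fact k * pochhammer (real d / 2) k)"
proof (induction k)
  case (Suc k)
  have *: "X / (F * P) * (- 1 / (4 * A * B)) = (- 1 / 4) * X / ((A * F) * (B * P))" for X F P A B :: real
    by (cases "F = 0 \<or> P = 0 \<or> A = 0 \<or> B = 0") (auto simp: field_simps)
  have "bessel_coeff d (Suc k) = bessel_coeff d k * (- 1 / (4 * (real k + 1) * (real d / 2 + real k)))"
    by (simp add: bessel_coeff_def)
  also have "\<dots> = (- 1 / 4) ^ Suc k / (((real k + 1) * fact k) * ((real d / 2 + real k) * pochhammer (real d / 2) k))"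
    unfolding Suc power_Suc by (rule *)
  also have "(real k + 1) * fact k = (fact (Suc k) :: real)" by (simp add: add.commute)
  finally show ?case by (simp only: pochhammer_rec')
qed (simp add: bessel_coeff_def)

lemma abs_bessel_coeff_le:
  assumes "d \<ge> 2"
  shows "\<bar>bessel_coeff d k\<bar> \<le> 1 / fact k"
proof -
  have "\<bar>bessel_coeff d k\<bar> = (\<Prod>i<k. 1 / (4 * (real i + 1) * (real d / 2 + real i)))"
    unfolding bessel_coeff_def abs_prod by (intro prod.cong refl) (simp add: abs_mult)
  also have "\<dots> \<le> (\<Prod>i<k. 1 / (real i + 1))"
  proof (intro prod_mono conjI)
    fix i assume "i \<in> {..<k}"
    have "1 * (1 * (real i + 1)) \<le> (4 * (real i + 1)) * (real d / 2 + real i)"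
      using assms by (subst mult.commute, intro mult_mono) auto
    then show "1 / (4 * (real i + 1) * (real d / 2 + real i)) \<le> 1 / (real i + 1)"
      by (intro divide_left_mono) (use assms in \<open>auto intro!: mult_pos_pos\<close>)
  qed auto
  also have "\<dots> = 1 / fact k"
    by (induction k) (auto simp: add.commute)
  finally show ?thesis .
qed

lemma summable_bessel_series:
  assumes "d \<ge> 2"
  shows "summable (\<lambda>k. norm (bessel_coeff d k * t ^ k))"
proof (rule summable_comparison_test')
  show "summable (\<lambda>k. \<bar>t\<bar> ^ k /\<^sub>R fact k)" by (rule summable_exp_generic)
  fix k :: nat
  show "norm (norm (bessel_coeff d k * t ^ k)) \<le> \<bar>t\<bar> ^ k /\<^sub>R fact k"
    using mult_right_mono[OF abs_bessel_coeff_le[OF assms, of k], of "\<bar>t\<bar> ^ k"]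
    by (simp add: abs_mult power_abs divide_simps mult_ac)
qed

lemma isCont_bessel_series:
  assumes "d \<ge> 2"
  shows "isCont (bessel_series d) t"
  unfolding bessel_series_def[abs_def]
  by (rule isCont_powser_converges_everywhere, rule summable_norm_cancel, rule summable_bessel_series[OF assms])

lemma bessel_series_0 [simp]: "bessel_series d 0 = 1"
  unfolding bessel_series_def by (subst powser_zero) (simp add: bessel_coeff_def)

lemma tendsto_mult_sin_divide: "(\<lambda>n. real (Suc n) * sin (c / real (Suc n))) \<longlonglongrightarrow> c"
proof (cases "c = 0")
  case False
  have "((\<lambda>x::real. sin x / x) \<longlongrightarrow> 1) (at 0)"
    using DERIV_sin[of 0] by (simp add: has_field_derivative_iff)
  moreover have "filterlim (\<lambda>n. c / real (Suc n)) (at 0) sequentially"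
    using False by (intro filterlim_atI LIMSEQ_Suc[OF lim_const_over_n]) auto
  ultimately have "(\<lambda>n. c * (sin (c / real (Suc n)) / (c / real (Suc n)))) \<longlonglongrightarrow> c * 1"
    by (intro tendsto_mult tendsto_const) (rule filterlim_compose)
  then show ?thesis using False by (simp add: mult.commute)
qed simp

text \<open>With the half angle h = psi / (2 n), the two base variables of
  \<open>gegenbauer_G_altdef\<close> are - sin^2 h and cos^2 h. Moving n^(2s) from the coefficient
  to sin^(2s) h makes every term converge, and Tannery's theorem sums the limits. The degree is
  taken as \<open>Suc n\<close> to keep it positive.\<close>

lemma Mehler_Heine:
  assumes "d \<ge> 2" "\<psi> \<ge> 0"
  shows "(\<lambda>n. gegenbauer_G n d (cos (\<psi> / real n))) \<longlonglongrightarrow> bessel_series d (\<psi>\<^sup>2)"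
proof -
  define a where "a = real d / 2 - 1"
  have a: "a \<ge> 0" using assms by (simp add: a_def)
  have "d > 0" using assms by simp
  define h where "h = (\<lambda>n. \<psi> / 2 / real (Suc n))"
  define w where "w = (\<lambda>s n. (\<Prod>i<s. ((real (Suc n) - real i) / real (Suc n) * ((real (Suc n) + a - real i) / real (Suc n))) / ((real i + 1) * (a + 1 + real i))))"
  define T where "T = (\<lambda>s n. w s n * (- ((real (Suc n) * sin (h n))\<^sup>2)) ^ s * ((cos (h n))\<^sup>2) ^ (Suc n - s))"
  have w: "gegenbauer_coeff (Suc n) a s = w s n * (real (Suc n))\<^sup>2 ^ s" for s n
  proof (induction s)
    case (Suc s)
    have *: "x * y / z = (x / N * (y / N) / z) * N\<^sup>2" if "N \<noteq> 0" for x y z N :: real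
      using that by (simp add: power2_eq_square)
    have N: "real (Suc n) \<noteq> 0" by simp
    have w_Suc: "w (Suc s) n = w s n * ((real (Suc n) - real s) / real (Suc n) * ((real (Suc n) + a - real s) / real (Suc n)) / ((real s + 1) * (a + 1 + real s)))"
      by (simp add: w_def del: of_nat_Suc)
    show ?case
      unfolding gegenbauer_coeff_Suc Suc w_Suc *[OF N, of "real (Suc n) - real s" "real (Suc n) + a - real s"]
      by (simp only: power_Suc mult_ac)
  qed (simp add: w_def)
  have G: "gegenbauer_G (Suc n) d (cos (\<psi> / real (Suc n))) = (\<Sum>s. T s n)" for n
  proof -
    have c: "\<psi> / real (Suc n) = 2 * h n" by (simp add: h_def del: of_nat_Suc)
    have "(cos (2 * h n) - 1) / 2 = - (sin (h n))\<^sup>2" "(cos (2 * h n) + 1) / 2 = (cos (h n))\<^sup>2"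
      using cos_double_sin[of "h n"] cos_double_cos[of "h n"] by simp_all
    moreover have pw: "(- ((real (Suc n) * z)\<^sup>2)) ^ s = ((real (Suc n))\<^sup>2) ^ s * (- (z\<^sup>2)) ^ s" for z s
      by (simp only: power_mult_distrib[symmetric] mult_minus_right)
    ultimately have "gegenbauer_G (Suc n) d (cos (\<psi> / real (Suc n))) = (\<Sum>s\<le>Suc n. T s n)"
      unfolding gegenbauer_G_altdef[OF \<open>d > 0\<close>] c T_def a_def[symmetric] w
      by (simp only: pw mult.assoc)
    also have "\<dots> = (\<Sum>s. T s n)"
    proof (rule suminf_finite[symmetric])
      fix s assume "s \<notin> {..Suc n}"
      then have "gegenbauer_coeff (Suc n) a s = 0" by (intro gegenbauer_coeff_eq_0) auto
      then show "T s n = 0" unfolding w T_def by simp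
    qed auto
    finally show ?thesis .
  qed
  have w_lim: "(\<lambda>n. w s n) \<longlonglongrightarrow> (\<Prod>i<s. 1 / ((real i + 1) * (a + 1 + real i)))" for s
    unfolding w_def
  proof (rule tendsto_prod)
    fix i
    have "(\<lambda>n. (1 - real i / real (Suc n)) * (1 + (a - real i) / real (Suc n)) / ((real i + 1) * (a + 1 + real i)))
        \<longlonglongrightarrow> (1 - 0) * (1 + 0) / ((real i + 1) * (a + 1 + real i))"
      using a by (intro tendsto_intros LIMSEQ_Suc[OF lim_const_over_n]) auto
    moreover have "(real (Suc n) - real i) / real (Suc n) = 1 - real i / real (Suc n)"
       "(real (Suc n) + a - real i) / real (Suc n) = 1 + (a - real i) / real (Suc n)" for n
      by (simp_all add: diff_divide_distrib add_divide_distrib del: of_nat_Suc)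
    ultimately show "(\<lambda>n. (real (Suc n) - real i) / real (Suc n) * ((real (Suc n) + a - real i) / real (Suc n)) / ((real i + 1) * (a + 1 + real i)))
      \<longlonglongrightarrow> 1 / ((real i + 1) * (a + 1 + real i))" by simp
  qed
  \<comment> \<open>The exponent grows with n, but Bernoulli's inequality gives the lower bound 1 -
    N h^2 = 1 - (psi / 2)^2 / N for N = n + 1.\<close>
  have cos_lim: "(\<lambda>n. ((cos (h n))\<^sup>2) ^ (Suc n - s)) \<longlonglongrightarrow> 1" for s
  proof (rule tendsto_sandwich)
    show "\<forall>\<^sub>F n in sequentially. 1 - (\<psi> / 2)\<^sup>2 / real (Suc n) \<le> ((cos (h n))\<^sup>2) ^ (Suc n - s)"
    proof (intro always_eventually allI)
      fix n
      have le: "(sin (h n))\<^sup>2 \<le> (h n)\<^sup>2" using abs_sin_x_le_abs_x[of "h n"] by (simp add: abs_le_square_iff)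
      have "1 - (\<psi> / 2)\<^sup>2 / real (Suc n) = 1 - real (Suc n) * (h n)\<^sup>2"
        by (simp add: h_def power_divide power2_eq_square del: of_nat_Suc)
      also have "\<dots> \<le> 1 - real (Suc n - s) * (sin (h n))\<^sup>2"
        using mult_mono[of "real (Suc n - s)" "real (Suc n)", OF _ le] by simp
      also have "\<dots> = 1 + real (Suc n - s) * (- (sin (h n))\<^sup>2)" by simp
      also have "\<dots> \<le> (1 + - (sin (h n))\<^sup>2) ^ (Suc n - s)"
        by (rule Bernoulli_inequality) (simp add: abs_square_le_1)
      finally show "1 - (\<psi> / 2)\<^sup>2 / real (Suc n) \<le> ((cos (h n))\<^sup>2) ^ (Suc n - s)"
        by (simp add: cos_squared_eq)
    qed
    show "\<forall>\<^sub>F n in sequentially. ((cos (h n))\<^sup>2) ^ (Suc n - s) \<le> 1"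
      by (intro always_eventually allI, rule power_le_one) (auto simp: abs_square_le_1)
    have "(\<lambda>n. 1 - (\<psi> / 2)\<^sup>2 / real (Suc n)) \<longlonglongrightarrow> 1 - 0"
      by (intro tendsto_intros LIMSEQ_Suc[OF lim_const_over_n])
    then show "(\<lambda>n. 1 - (\<psi> / 2)\<^sup>2 / real (Suc n)) \<longlonglongrightarrow> 1" by simp
  qed simp
  have lim: "(\<lambda>n. T s n) \<longlonglongrightarrow> bessel_coeff d s * \<psi>\<^sup>2 ^ s" for s
  proof -
    have "(\<lambda>n. T s n) \<longlonglongrightarrow> (\<Prod>i<s. 1 / ((real i + 1) * (a + 1 + real i))) * (- ((\<psi> / 2)\<^sup>2)) ^ s * 1"
      unfolding T_def using tendsto_mult_sin_divide[of "\<psi> / 2"]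
      by (intro tendsto_intros w_lim cos_lim) (simp add: h_def)
    also have "(\<Prod>i<s. 1 / ((real i + 1) * (a + 1 + real i))) * (- ((\<psi> / 2)\<^sup>2)) ^ s * 1 = bessel_coeff d s * \<psi>\<^sup>2 ^ s"
    proof -
      have "bessel_coeff d s = (\<Prod>i<s. 1 / ((real i + 1) * (a + 1 + real i)) * (- 1 / 4))"
        unfolding bessel_coeff_def by (intro prod.cong refl) (simp add: a_def)
      also have "\<dots> = (\<Prod>i<s. 1 / ((real i + 1) * (a + 1 + real i))) * (- 1 / 4) ^ s"
        by (simp only: prod.distrib prod_constant card_lessThan)
      finally show ?thesis
        by (simp only: mult.assoc power_mult_distrib[symmetric]) (simp add: power_divide)
    qed
    finally show ?thesis .
  qed
  \<comment> \<open>With N = n + 1 and i <= N, the inequality N + a - i <= (1 + a) N bounds each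
    factor of \<open>w\<close> by (1 + a) / (i + 1). Together with |N sin h| <= psi / 2 this yields
    a term of an exponential series, independent of n.\<close>
  define M where "M = (\<lambda>s. ((1 + a) * (\<psi> / 2)\<^sup>2) ^ s /\<^sub>R fact s)"
  have bound: "norm (T s n) \<le> M s" for s n
  proof (cases "s \<le> Suc n")
    case False
    then have "gegenbauer_coeff (Suc n) a s = 0" by (intro gegenbauer_coeff_eq_0) auto
    then have "T s n = 0" unfolding w T_def by simp
    then show ?thesis using a by (simp add: M_def)
  next
    case True
    have "\<bar>w s n\<bar> \<le> (\<Prod>i<s. (1 + a) / (real i + 1))"
      unfolding w_def abs_prod
    proof (intro prod_mono conjI)
      fix i assume "i \<in> {..<s}"
      then have i: "real i \<le> real (Suc n)" using True by simp
      have 1: "0 \<le> (real (Suc n) - real i) / real (Suc n)" "(real (Suc n) - real i) / real (Suc n) \<le> 1"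
        using i by (auto simp: field_simps)
      have "a \<le> a * real (Suc n)" using a by (simp add: mult_le_cancel_left1)
      then have 2: "0 \<le> (real (Suc n) + a - real i) / real (Suc n)" "(real (Suc n) + a - real i) / real (Suc n) \<le> 1 + a"
        using i a by (auto simp: divide_le_eq algebra_simps simp del: of_nat_Suc)
      have 3: "(real (Suc n) - real i) / real (Suc n) * ((real (Suc n) + a - real i) / real (Suc n)) \<le> 1 * (1 + a)"
        using 1 2 by (intro mult_mono) auto
      have "\<bar>(real (Suc n) - real i) / real (Suc n) * ((real (Suc n) + a - real i) / real (Suc n)) / ((real i + 1) * (a + 1 + real i))\<bar>
        = (real (Suc n) - real i) / real (Suc n) * ((real (Suc n) + a - real i) / real (Suc n)) / ((real i + 1) * (a + 1 + real i))"
        using i a by (intro abs_of_nonneg divide_nonneg_nonneg mult_nonneg_nonneg) auto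
      also have "\<dots> \<le> (1 * (1 + a)) / ((real i + 1) * 1)"
        using a i by (intro frac_le 3 mult_left_mono) auto
      finally show "\<bar>(real (Suc n) - real i) / real (Suc n) * ((real (Suc n) + a - real i) / real (Suc n)) / ((real i + 1) * (a + 1 + real i))\<bar> \<le> (1 + a) / (real i + 1)"
        by simp
    qed auto
    also have "\<dots> = (1 + a) ^ s / fact s"
      by (induction s) (auto simp: add.commute mult.commute)
    finally have w_le: "\<bar>w s n\<bar> \<le> (1 + a) ^ s / fact s" .
    have "\<bar>real (Suc n) * sin (h n)\<bar> \<le> real (Suc n) * \<bar>h n\<bar>"
      unfolding abs_mult using abs_sin_x_le_abs_x[of "h n"] by (intro mult_mono) auto
    also have "\<dots> = \<bar>\<psi> / 2\<bar>" using assms by (simp add: h_def del: of_nat_Suc)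
    finally have "(real (Suc n) * sin (h n))\<^sup>2 \<le> (\<psi> / 2)\<^sup>2" by (simp only: abs_le_square_iff)
    then have "\<bar>(- ((real (Suc n) * sin (h n))\<^sup>2)) ^ s\<bar> \<le> ((\<psi> / 2)\<^sup>2) ^ s"
      unfolding power_abs by (intro power_mono) auto
    moreover have "\<bar>((cos (h n))\<^sup>2) ^ (Suc n - s)\<bar> \<le> 1"
      unfolding power_abs by (rule power_le_one) (auto simp: abs_square_le_1)
    ultimately have "norm (T s n) \<le> ((1 + a) ^ s / fact s) * ((\<psi> / 2)\<^sup>2) ^ s * 1"
      unfolding T_def real_norm_def abs_mult using w_le a by (intro mult_mono) auto
    also have "\<dots> = M s" by (simp only: M_def real_scaleR_def power_mult_distrib[of "1 + a"] divide_inverse[of _ "fact s"] mult_1_right mult_ac)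
    finally show ?thesis .
  qed
  have "(\<lambda>n. \<Sum>s. T s n) \<longlonglongrightarrow> (\<Sum>s. bessel_coeff d s * \<psi>\<^sup>2 ^ s)"
  proof -
    have 1: "\<forall>\<^sub>F (k, n) in sequentially \<times>\<^sub>F sequentially. norm (T k n) \<le> M k"
      using bound by (intro always_eventually) auto
    have 2: "summable M" unfolding M_def by (rule summable_exp_generic)
    show ?thesis using tannerys_theorem[OF lim 1 2 sequentially_bot] by (rule conjunct2[OF conjunct2])
  qed
  then have "(\<lambda>n. gegenbauer_G (Suc n) d (cos (\<psi> / real (Suc n)))) \<longlonglongrightarrow> bessel_series d (\<psi>\<^sup>2)"
    unfolding G bessel_series_def .
  then show ?thesis by (rule LIMSEQ_imp_Suc)
qed

subsection \<open>Dominated convergence\<close>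

text \<open>The leading 4 comes from \<open>gegenbauer_decay\<close>, and 4^(d - 1) from replacing n
  sin(psi / n) by psi with \<open>sin_ge_quarter\<close>; d - 1 is rounded up to d.\<close>

definition decay_const :: "nat \<Rightarrow> real" where
  "decay_const d = 4 * (4 * real d) ^ (d - 1)"

lemma decay_const_ge_1:
  assumes "d \<ge> 3" shows "decay_const d \<ge> 1"
proof -
  have "1 \<le> (4 * real d) ^ (d - 1)" using assms by (intro one_le_power) auto
  then show ?thesis by (simp add: decay_const_def)
qed

text \<open>A weak form of Jordan's inequality: up to pi/3 the derivative cos is at least 1/2, and
  beyond it sin t >= 1/2 while t / 4 < 1/2.\<close>

lemma sin_ge_quarter:
  assumes "0 \<le> t" "t \<le> pi / 2"
  shows "t / 4 \<le> sin t"
proof (cases "t \<le> pi / 3")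
  case True
  have "sin 0 - 0 / 4 \<le> sin t - t / 4"
  proof (rule DERIV_nonneg_imp_nondecreasing[OF assms(1)])
    fix x assume x: "0 \<le> x" "x \<le> t"
    have "cos (pi / 3) \<le> cos x" using x True by (intro cos_monotone_0_pi_le) auto
    then have "1 / 2 \<le> cos x" by (simp add: cos_60)
    then show "\<exists>y. ((\<lambda>x. sin x - x / 4) has_real_derivative y) (at x) \<and> 0 \<le> y"
      by (intro exI[of _ "cos x - 1 / 4"]) (auto intro!: derivative_eq_intros)
  qed
  then show ?thesis by simp
next
  case False
  have "sin (pi / 6) \<le> sin t" using False assms by (intro sin_monotone_2pi_le) auto
  then show ?thesis using assms pi_half_less_two by (simp add: sin_30)
qed

lemma gegenbauer_decay_scaled:
  assumes "d \<ge> 3" "n > 0" "0 < \<psi>" "\<psi> \<le> real n * (pi / 2)"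
  shows "(gegenbauer_G n d (cos (\<psi> / real n)))\<^sup>2 * \<psi> ^ (d - 1) \<le> decay_const d"
proof -
  define t where "t = \<psi> / real n"
  have t: "0 < t" "t \<le> pi / 2" using assms by (auto simp: t_def field_simps)
  have \<psi>: "\<psi> = real n * t" using assms by (simp add: t_def)
  define X where "X = (gegenbauer_G n d (cos t))\<^sup>2"
  have "\<psi> \<le> 4 * (real n * sin t)"
    using sin_ge_quarter[of t] t mult_left_mono[of "t / 4" "sin t" "real n"] unfolding \<psi> by auto
  then have "X * \<psi> ^ (d - 1) \<le> X * (4 * (real n * sin t)) ^ (d - 1)"
    using assms by (intro mult_left_mono power_mono) (auto simp: X_def)
  also have "\<dots> = 4 ^ (d - 1) * ((real n * sin t) ^ (d - 1) * X)"
    unfolding power_mult_distrib[of 4] by (simp only: mult_ac)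
  also have "\<dots> \<le> 4 ^ (d - 1) * (4 * (real d - 1) ^ (d - 1))"
    using gegenbauer_decay[OF assms(1,2) t] unfolding X_def by (intro mult_left_mono) auto
  also have "\<dots> \<le> 4 ^ (d - 1) * (4 * real d ^ (d - 1))"
    using assms by (intro mult_left_mono power_mono) auto
  also have "\<dots> = decay_const d" unfolding decay_const_def power_mult_distrib by simp
  finally show ?thesis by (simp add: X_def t_def)
qed

lemma gegenbauer_abs_le_1:
  assumes "d \<ge> 3" "0 \<le> \<theta>" "\<theta> \<le> pi / 2"
  shows "\<bar>gegenbauer_G n d (cos \<theta>)\<bar> \<le> 1"
proof (cases "n = 0")
  case True
  then show ?thesis using assms by (simp add: gegenbauer_G_altdef)
next
  case False
  moreover have "d \<ge> 1" using assms by simp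
  ultimately show ?thesis using gegenbauer_theta[of d n] assms by blast
qed

lemma eventually_divide_le_pi_half: "\<forall>\<^sub>F n in sequentially. n > 0 \<and> \<psi> \<le> real n * (pi / 2)"
proof -
  have "filterlim (\<lambda>n. real n * (pi / 2)) at_top sequentially"
    by (intro filterlim_tendsto_pos_mult_at_top_iff[THEN iffD2, OF tendsto_const] 
      filterlim_at_top_mult_tendsto_pos[OF tendsto_const] filterlim_real_sequentially) auto
  then have "\<forall>\<^sub>F n in sequentially. \<psi> \<le> real n * (pi / 2)" by (simp add: filterlim_at_top)
  with eventually_gt_at_top[of 0] show ?thesis by (rule eventually_conj)
qed

lemma bessel_series_abs_le_1:
  assumes "d \<ge> 3"
  shows "\<bar>bessel_series d (\<psi>\<^sup>2)\<bar> \<le> 1"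
proof -
  have *: "\<bar>bessel_series d (\<psi>\<^sup>2)\<bar> \<le> 1" if "\<psi> \<ge> 0" for \<psi> :: real
  proof (rule LIMSEQ_le_const2)
    show "(\<lambda>n. \<bar>gegenbauer_G n d (cos (\<psi> / real n))\<bar>) \<longlonglongrightarrow> \<bar>bessel_series d (\<psi>\<^sup>2)\<bar>"
      using assms that by (intro tendsto_rabs Mehler_Heine) auto
    show "\<exists>N. \<forall>n\<ge>N. \<bar>gegenbauer_G n d (cos (\<psi> / real n))\<bar> \<le> 1"
      unfolding eventually_sequentially[symmetric]
      using eventually_divide_le_pi_half[of \<psi>]
      by eventually_elim (use that assms in \<open>auto intro!: gegenbauer_abs_le_1 simp: field_simps\<close>)
  qed
  show ?thesis using *[of "\<bar>\<psi>\<bar>"] by simp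
qed

text \<open>The exponent 3/2 is the smallest value of (q/2 - 1)(d - 1) over the pairs other than (3,
  3), attained at d = 4, q = 3. Near 0 the integrand is at most 1.\<close>

definition dominator :: "nat \<Rightarrow> real \<Rightarrow> real" where
  "dominator d \<psi> = (if \<psi> \<in> {0..1} then 1 else 0) + (if \<psi> \<in> {1..} then (decay_const d)\<^sup>2 * \<psi> powr (- (3 / 2)) else 0)"

lemma dominator_integrable: "dominator d integrable_on {0..}"
proof -
  have "(\<lambda>\<psi>::real. \<psi> powr (- (3 / 2))) integrable_on {1..}"
    using has_integral_powr_to_inf[of "- (3 / 2)" 1] by (auto simp: integrable_on_def)
  then have "(\<lambda>\<psi>::real. (decay_const d)\<^sup>2 * \<psi> powr (- (3 / 2))) integrable_on {1..}"
    by (rule integrable_on_mult_right)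
  then have "(\<lambda>\<psi>. if \<psi> \<in> {1..} then (decay_const d)\<^sup>2 * \<psi> powr (- (3 / 2)) else 0) integrable_on {0..}"
    by (subst integrable_restrict_Int) (simp add: Int_absorb2)
  moreover have "(\<lambda>\<psi>::real. if \<psi> \<in> {0..1} then 1 else 0 :: real) integrable_on {0..}"
    by (subst integrable_restrict_Int) (auto simp: Int_absorb2 intro!: integrable_continuous_interval)
  ultimately show ?thesis unfolding dominator_def[abs_def] by (intro integrable_add)
qed

text \<open>In the application x is a Gegenbauer value and s is n sin(psi / n), which stays below
  psi.\<close>

lemma dominator_bound:
  assumes "d \<ge> 3" "q \<ge> 3" "(d, q) \<noteq> (3, 3)" "0 \<le> \<psi>" "\<bar>x\<bar> \<le> 1" "x\<^sup>2 * \<psi> ^ (d - 1) \<le> decay_const d"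
    "0 \<le> s" "s \<le> \<psi>"
  shows "norm (x ^ q * s ^ (d - 1)) \<le> dominator d \<psi>"
proof -
  define D where "D = d - 1"
  have D: "D \<ge> 2" using assms by (auto simp: D_def)
  define C where "C = decay_const d"
  have C: "C \<ge> 1" using decay_const_ge_1[OF assms(1)] by (simp add: C_def)
  have "norm (x ^ q * s ^ (d - 1)) = \<bar>x\<bar> ^ q * s ^ D"
    using assms by (simp add: D_def abs_mult power_abs)
  also have "\<dots> \<le> \<bar>x\<bar> ^ q * \<psi> ^ D" using assms by (intro mult_left_mono power_mono) auto
  also have "\<dots> \<le> dominator d \<psi>"
  proof (cases "\<psi> < 1")
    case True
    have "\<bar>x\<bar> ^ q * \<psi> ^ D \<le> 1 * 1"
      using assms True by (intro mult_mono power_le_one) auto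
    then show ?thesis using True assms by (simp add: dominator_def)
  next
    case False
    then have \<psi>: "\<psi> \<ge> 1" by simp
    define X where "X = x\<^sup>2"
    have X: "0 \<le> X" "X \<le> 1" "X * \<psi> ^ D \<le> C" using assms by (auto simp: X_def D_def C_def abs_square_le_1)
    \<comment> \<open>The bound is proved for squares, where the exponents are integers. For d = 3
      and q >= 4 the power psi^7 is absorbed by psi^8 = (psi^2)^4; for d >= 4 one has 2 D + 3 <= 3
      D.\<close>
    have key: "X ^ q * (\<psi> ^ (2 * D) * \<psi> ^ 3) \<le> C ^ 4"
    proof (cases "d = 3")
      case True
      then have "q \<ge> 4" "D = 2" using assms by (auto simp: D_def)
      have "X ^ q * (\<psi> ^ (2 * D) * \<psi> ^ 3) \<le> X ^ 4 * \<psi> ^ (D * 4)"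
        unfolding power_add[symmetric] using \<open>q \<ge> 4\<close> X \<psi>
        by (intro mult_mono power_decreasing power_increasing) (auto simp: \<open>D = 2\<close>)
      also have "\<dots> = (X * \<psi> ^ D) ^ 4" by (simp add: power_mult_distrib power_mult)
      also have "\<dots> \<le> C ^ 4" using X \<psi> by (intro power_mono) auto
      finally show ?thesis .
    next
      case False
      then have "D \<ge> 3" using assms by (auto simp: D_def)
      have "X ^ q * (\<psi> ^ (2 * D) * \<psi> ^ 3) \<le> X ^ 3 * \<psi> ^ (D * 3)"
        unfolding power_add[symmetric] using \<open>D \<ge> 3\<close> X \<psi> assms
        by (intro mult_mono power_decreasing power_increasing) auto
      also have "\<dots> = (X * \<psi> ^ D) ^ 3" by (simp add: power_mult_distrib power_mult)
      also have "\<dots> \<le> C ^ 3" using X \<psi> by (intro power_mono) auto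
      also have "\<dots> \<le> C ^ 4" using C by (intro power_increasing) auto
      finally show ?thesis .
    qed
    have sq: "(\<psi> powr (3 / 2))\<^sup>2 = \<psi> ^ 3"
      using \<psi> by (simp add: power2_eq_square powr_add[symmetric] powr_numeral)
    have "(\<bar>x\<bar> ^ q * \<psi> ^ D * \<psi> powr (3 / 2))\<^sup>2 = X ^ q * (\<psi> ^ (2 * D) * \<psi> ^ 3)"
      unfolding power_mult_distrib sq X_def
      by (simp add: power_mult[symmetric] power_even_abs mult.commute mult.assoc)
    also have "\<dots> \<le> (C\<^sup>2)\<^sup>2" using key by (simp add: power_mult[symmetric])
    finally have "\<bar>x\<bar> ^ q * \<psi> ^ D * \<psi> powr (3 / 2) \<le> C\<^sup>2" by (rule power2_le_imp_le) simp
    then have "\<bar>x\<bar> ^ q * \<psi> ^ D \<le> C\<^sup>2 * \<psi> powr (- (3 / 2))"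
      using \<psi> by (simp add: powr_minus field_simps)
    also have "\<dots> \<le> dominator d \<psi>" using \<psi> by (simp add: dominator_def C_def)
    finally show ?thesis .
  qed
  finally show ?thesis .
qed

text \<open>Under theta = psi / n, one factor n comes from the measure and the remaining n^(d - 1)
  joins the sine. The cutoff places all degrees on the same half-line, as dominated convergence
  requires.\<close>

lemma gegenbauer_integral_scaled:
  assumes "d > 0" "n > 0"
  shows "((\<lambda>\<psi>. if \<psi> \<in> {0..real n * (pi / 2)} then gegenbauer_G n d (cos (\<psi> / real n)) ^ q * (real n * sin (\<psi> / real n)) ^ (d - 1) else 0)
     has_integral real n ^ d * integral {0..pi / 2} (\<lambda>\<theta>. gegenbauer_G n d (cos \<theta>) ^ q * sin \<theta> ^ (d - 1))) {0..}"
proof -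
  define f where "f = (\<lambda>\<theta>. gegenbauer_G n d (cos \<theta>) ^ q * sin \<theta> ^ (d - 1))"
  have "continuous_on {0..pi / 2} f"
    unfolding f_def gegenbauer_G_altdef[OF assms(1)] by (intro continuous_intros) auto
  then have "(f has_integral integral {0..pi / 2} f) {0..pi / 2}"
    by (intro integrable_integral integrable_continuous_interval)
  from has_integral_stretch_real[OF this, of "1 / real n"]
  have "((\<lambda>\<psi>. f (\<psi> / real n)) has_integral real n * integral {0..pi / 2} f) ((\<lambda>x. x * real n) ` {0..pi / 2})"
    using assms by simp
  also have "(\<lambda>x. x * real n) ` {0..pi / 2} = {0..real n * (pi / 2)}"
    using image_mult_atLeastAtMost[of "real n" 0 "pi / 2"] assms by (simp add: mult.commute[of _ "real n"])
  finally have "((\<lambda>\<psi>. real n ^ (d - 1) * f (\<psi> / real n)) has_integral real n ^ (d - 1) * (real n * integral {0..pi / 2} f)) {0..real n * (pi / 2)}"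
    by (rule has_integral_mult_right)
  also have "real n ^ (d - 1) * (real n * integral {0..pi / 2} f) = real n ^ d * integral {0..pi / 2} f"
    using assms by (cases d) auto
  also have "(\<lambda>\<psi>. real n ^ (d - 1) * f (\<psi> / real n)) = (\<lambda>\<psi>. gegenbauer_G n d (cos (\<psi> / real n)) ^ q * (real n * sin (\<psi> / real n)) ^ (d - 1))"
    by (simp add: f_def power_mult_distrib mult_ac)
  finally show ?thesis unfolding f_def by (subst has_integral_restrict) auto
qed

lemma gegenbauer_moment_limit:
  assumes "d \<ge> 3" "q \<ge> 3" "(d, q) \<noteq> (3, 3)"
  defines "F \<equiv> \<lambda>\<psi>. bessel_series d (\<psi>\<^sup>2) ^ q * \<psi> ^ (d - 1)"
  shows "F absolutely_integrable_on {0..}"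
    and "(\<lambda>n. real n ^ d * integral {0..pi / 2} (\<lambda>\<theta>. gegenbauer_G n d (cos \<theta>) ^ q * sin \<theta> ^ (d - 1))) \<longlonglongrightarrow> integral {0..} F"
proof -
  define f where "f = (\<lambda>n \<psi>. if \<psi> \<in> {0..real (Suc n) * (pi / 2)} then gegenbauer_G (Suc n) d (cos (\<psi> / real (Suc n))) ^ q * (real (Suc n) * sin (\<psi> / real (Suc n))) ^ (d - 1) else 0)"
  have f: "(f n has_integral real (Suc n) ^ d * integral {0..pi / 2} (\<lambda>\<theta>. gegenbauer_G (Suc n) d (cos \<theta>) ^ q * sin \<theta> ^ (d - 1))) {0..}" for n
    unfolding f_def using assms by (intro gegenbauer_integral_scaled) auto
  have le: "norm (f n \<psi>) \<le> dominator d \<psi>" if "\<psi> \<in> {0..}" for n \<psi>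
  proof (cases "\<psi> \<in> {0..real (Suc n) * (pi / 2)}")
    case True
    have t: "0 \<le> \<psi> / real (Suc n)" "\<psi> / real (Suc n) \<le> pi / 2"
      using True by (auto simp: field_simps simp del: of_nat_Suc)
    have "norm (gegenbauer_G (Suc n) d (cos (\<psi> / real (Suc n))) ^ q * (real (Suc n) * sin (\<psi> / real (Suc n))) ^ (d - 1)) \<le> dominator d \<psi>"
    proof (rule dominator_bound[OF assms(1-3)])
      show "\<bar>gegenbauer_G (Suc n) d (cos (\<psi> / real (Suc n)))\<bar> \<le> 1"
        by (intro gegenbauer_abs_le_1 assms t)
      show "(gegenbauer_G (Suc n) d (cos (\<psi> / real (Suc n))))\<^sup>2 * \<psi> ^ (d - 1) \<le> decay_const d"
      proof (cases "\<psi> = 0")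
        case True
        then show ?thesis using decay_const_ge_1[OF assms(1)] assms(1) by (simp add: zero_power)
      next
        case False
        then show ?thesis using True by (intro gegenbauer_decay_scaled assms) auto
      qed
      show "0 \<le> real (Suc n) * sin (\<psi> / real (Suc n))"
        using t(1) order_trans[OF t(2), of pi] by (intro mult_nonneg_nonneg sin_ge_zero) auto
      have "real (Suc n) * sin (\<psi> / real (Suc n)) \<le> real (Suc n) * (\<psi> / real (Suc n))"
        by (intro mult_left_mono sin_x_le_x t) auto
      then show "real (Suc n) * sin (\<psi> / real (Suc n)) \<le> \<psi>" by (simp del: of_nat_Suc)
    qed (use that in auto)
    then show ?thesis using True by (simp only: f_def if_True)
  next
    case False
    then show ?thesis by (auto simp: f_def dominator_def)
  qed
  have lim: "(\<lambda>n. f n \<psi>) \<longlonglongrightarrow> F \<psi>" if "\<psi> \<in> {0..}" for \<psi>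
  proof -
    have "(\<lambda>n. gegenbauer_G (Suc n) d (cos (\<psi> / real (Suc n))) ^ q * (real (Suc n) * sin (\<psi> / real (Suc n))) ^ (d - 1)) \<longlonglongrightarrow> F \<psi>"
      unfolding F_def using assms that
      by (intro tendsto_intros tendsto_mult_sin_divide LIMSEQ_Suc[OF Mehler_Heine]) auto
    moreover have "\<forall>\<^sub>F n in sequentially. gegenbauer_G (Suc n) d (cos (\<psi> / real (Suc n))) ^ q * (real (Suc n) * sin (\<psi> / real (Suc n))) ^ (d - 1) = f n \<psi>"
      using eventually_divide_le_pi_half[of \<psi>, THEN eventually_sequentially_Suc[THEN iffD2]]
      by eventually_elim (use that in \<open>auto simp: f_def\<close>)
    ultimately show ?thesis by (rule Lim_transform_eventually)
  qed
  have fi: "f n integrable_on {0..}" for n using f[of n] by (rule has_integral_integrable)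
  note dc = dominated_convergence[OF fi dominator_integrable le lim]
  \<comment> \<open>The uniform bound passes to the pointwise limit, so absolute integrability of F
    comes from the same dominator.\<close>
  have "norm (F \<psi>) \<le> dominator d \<psi>" if "\<psi> \<in> {0..}" for \<psi>
    using LIMSEQ_le_const2[OF tendsto_norm[OF lim[OF that]]] le[OF that] by blast
  then show "F absolutely_integrable_on {0..}"
    by (rule absolutely_integrable_integrable_bound[OF _ dc(1) dominator_integrable])
  have "(\<lambda>n. real (Suc n) ^ d * integral {0..pi / 2} (\<lambda>\<theta>. gegenbauer_G (Suc n) d (cos \<theta>) ^ q * sin \<theta> ^ (d - 1))) \<longlonglongrightarrow> integral {0..} F"
    using dc(2) f[THEN integral_unique] by simp
  then show "(\<lambda>n. real n ^ d * integral {0..pi / 2} (\<lambda>\<theta>. gegenbauer_G n d (cos \<theta>) ^ q * sin \<theta> ^ (d - 1))) \<longlonglongrightarrow> integral {0..} F"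
    by (rule LIMSEQ_imp_Suc)
qed

text \<open>Multiplication by Gamma (d/2) turns each reciprocal Gamma value into the reciprocal of a
  Pochhammer symbol, so the two series agree term by term; the powers of 2 cancel against (x / 2)
  powr (d/2 - 1).\<close>

lemma bessel_J_altdef:
  assumes "d \<ge> 2" "x > 0"
  shows "2 powr (real d / 2 - 1) * Gamma (real d / 2) * bessel_J (real d / 2 - 1) x = x powr (real d / 2 - 1) * bessel_series d (x\<^sup>2)"
proof -
  define \<nu> where "\<nu> = real d / 2 - 1"
  have "d > 0" using assms by simp
  have G: "Gamma (real d / 2) > 0" using assms by (intro Gamma_real_pos) auto
  have termwise: "Gamma (real d / 2) * ((- 1) ^ k * rGamma (real k + \<nu> + 1) / fact k * (x / 2) ^ (2 * k)) = bessel_coeff d k * (x\<^sup>2) ^ k" for k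
  proof -
    have p: "pochhammer (real d / 2) k > 0" using assms by (intro pochhammer_pos) auto
    have "1 / Gamma (real d / 2) = pochhammer (real d / 2) k * rGamma (real d / 2 + real k)"
      unfolding pochhammer_rGamma[symmetric] by (simp only: rGamma_inverse_Gamma inverse_eq_divide)
    then have "Gamma (real d / 2) * rGamma (real d / 2 + real k) = 1 / pochhammer (real d / 2) k"
      using G p by (simp add: field_simps)
    note 1 = this
    have 2: "real k + \<nu> + 1 = real d / 2 + real k" by (simp add: \<nu>_def)
    have 3: "(x / 2) ^ (2 * k) = (1 / 4) ^ k * (x\<^sup>2) ^ k"
      by (simp only: power_mult power_mult_distrib[symmetric]) (simp add: power_divide)
    have 4: "(- 1) ^ k * (1 / 4) ^ k = (- (1 / 4) :: real) ^ k"
      by (simp only: power_mult_distrib[symmetric] mult_minus_left mult_1)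
    have "Gamma (real d / 2) * ((- 1) ^ k * rGamma (real k + \<nu> + 1) / fact k * (x / 2) ^ (2 * k))
      = (Gamma (real d / 2) * rGamma (real d / 2 + real k)) * ((- 1) ^ k * (1 / 4) ^ k) / fact k * (x\<^sup>2) ^ k"
      unfolding 2 3 by (simp only: times_divide_eq_right times_divide_eq_left mult_ac)
    also have "\<dots> = bessel_coeff d k * (x\<^sup>2) ^ k"
      unfolding 1 4 bessel_coeff_altdef[OF \<open>d > 0\<close>] by (simp add: mult.commute[of "fact k"])
    finally show ?thesis .
  qed
  have summ: "summable (\<lambda>k. bessel_coeff d k * (x\<^sup>2) ^ k)" 
    by (rule summable_norm_cancel, rule summable_bessel_series[OF assms(1)])
  have "Gamma (real d / 2) * (\<Sum>k. (- 1) ^ k * rGamma (real k + \<nu> + 1) / fact k * (x / 2) ^ (2 * k)) = bessel_series d (x\<^sup>2)"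
  proof -
    have "summable (\<lambda>k. (1 / Gamma (real d / 2)) * (Gamma (real d / 2) * ((- 1) ^ k * rGamma (real k + \<nu> + 1) / fact k * (x / 2) ^ (2 * k))))"
      unfolding termwise by (intro summable_mult summ)
    then have "summable (\<lambda>k. (- 1) ^ k * rGamma (real k + \<nu> + 1) / fact k * (x / 2) ^ (2 * k))"
      using G by simp
    from suminf_mult[OF this, of "Gamma (real d / 2)"] show ?thesis
      unfolding termwise bessel_series_def by simp
  qed
  moreover have "2 powr \<nu> * (x / 2) powr \<nu> = x powr \<nu>"
    using powr_mult[of 2 "x / 2" \<nu>] by simp
  moreover have rearrange: "A * G * (B * S) = (A * B) * (G * S)" for A G B S :: real by simp
  ultimately show ?thesis unfolding bessel_J_def \<nu>_def[symmetric]
    by (subst rearrange) (simp only:)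
qed

subsection \<open>The product formula and a Gaussian integral\<close>

text \<open>This is u'' + (d - 1) u' / x + u = 0 for u(x) = j(x), rewritten in t = x^2, where the
  solution is entire. Comparing powers of t reproduces the recursion of
  \<open>bessel_coeff\<close>.\<close>

lemma bessel_series_ode:
  assumes "d \<ge> 2"
  obtains B1 B2 where
    "\<And>t. (bessel_series d has_real_derivative B1 t) (at t)"
    "\<And>t. (B1 has_real_derivative B2 t) (at t)"
    "\<And>t. isCont B2 t"
    "\<And>t. 4 * t * B2 t + 2 * real d * B1 t + bessel_series d t = 0"
proof -
  define b where "b = bessel_coeff d"
  have s0: "summable (\<lambda>k. b k * t ^ k)" for t
    unfolding b_def by (rule summable_norm_cancel, rule summable_bessel_series[OF assms])
  have s1: "summable (\<lambda>k. diffs b k * t ^ k)" for t by (rule termdiff_converges_all[OF s0])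
  have s2: "summable (\<lambda>k. diffs (diffs b) k * t ^ k)" for t by (rule termdiff_converges_all[OF s1])
  define B1 where "B1 = (\<lambda>t. \<Sum>k. diffs b k * t ^ k)"
  define B2 where "B2 = (\<lambda>t. \<Sum>k. diffs (diffs b) k * t ^ k)"
  have ode: "4 * t * B2 t + 2 * real d * B1 t + bessel_series d t = 0" for t
  proof -
    have "(\<lambda>k. diffs (diffs b) k * t ^ k * t) sums (B2 t * t)"
      unfolding B2_def by (intro sums_mult2 summable_sums s2)
    also have "(\<lambda>k. diffs (diffs b) k * t ^ k * t) = (\<lambda>k. real (Suc k) * (real (Suc k) + 1) * b (Suc (Suc k)) * t ^ Suc k)"
      by (simp add: diffs_def mult_ac)
    finally have "(\<lambda>k. real k * (real k + 1) * b (Suc k) * t ^ k) sums (B2 t * t)"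
      by (subst (asm) sums_Suc_iff) simp
    from sums_add[OF sums_add[OF sums_mult[OF this, of 4] sums_mult[OF summable_sums[OF s1[of t]], of "2 * real d"]] summable_sums[OF s0[of t]]]
    have "(\<lambda>k. 4 * (real k * (real k + 1) * b (Suc k) * t ^ k) + 2 * real d * (diffs b k * t ^ k) + b k * t ^ k)
       sums (4 * (B2 t * t) + 2 * real d * B1 t + bessel_series d t)"
      unfolding B1_def bessel_series_def b_def .
    moreover have "4 * (real k * (real k + 1) * b (Suc k) * t ^ k) + 2 * real d * (diffs b k * t ^ k) + b k * t ^ k = 0" for k
    proof -
      define P where "P = 4 * (real k + 1) * (real d / 2 + real k)"
      have "P > 0" unfolding P_def using assms by (intro mult_pos_pos) auto
      moreover have "b (Suc k) = b k * (- 1 / P)" by (simp add: b_def bessel_coeff_def P_def)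
      ultimately have "P * b (Suc k) = - b k" by simp
      then have "(P * b (Suc k) + b k) * t ^ k = 0" by simp
      then show ?thesis by (simp add: P_def diffs_def algebra_simps)
    qed
    ultimately have "(\<lambda>k. 0) sums (4 * (B2 t * t) + 2 * real d * B1 t + bessel_series d t)" by simp
    then have "4 * (B2 t * t) + 2 * real d * B1 t + bessel_series d t = 0"
      using sums_unique2 sums_zero by blast
    then show ?thesis by (simp add: mult_ac)
  qed
  show thesis
  proof (rule that[OF _ _ _ ode])
    show "(bessel_series d has_real_derivative B1 t) (at t)" for t
      unfolding bessel_series_def[abs_def] B1_def b_def[symmetric] by (rule termdiffs_strong_converges_everywhere[OF s0])
    show "(B1 has_real_derivative B2 t) (at t)" for t
      unfolding B2_def B1_def by (rule termdiffs_strong_converges_everywhere[OF s1])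
    show "isCont B2 t" for t
      unfolding B2_def by (rule isCont_powser_converges_everywhere[OF s2])
  qed
qed

text \<open>The angle between a uniform unit vector in dimension d and a fixed axis has density
  proportional to sin^(d - 2); this is the normalising mass.\<close>

definition sphere_weight :: "nat \<Rightarrow> real" where
  "sphere_weight d = integral {0..pi} (\<lambda>\<phi>. sin \<phi> ^ (d - 2))"

text \<open>
  As functions of $x$, both sides solve $x^2 u'' + (d-1) x u' + x^2 u = 0$ with the same value and zero derivative
  at $0$. The energy of the difference, $e^2 + e'^2$, is nonincreasing on $[0,\infty)$, so it vanishes.
\<close>

lemma bessel_product_formula:
  assumes "d \<ge> 2" "x \<ge> 0"
  shows "integral {0..pi} (\<lambda>\<phi>. bessel_series d (x\<^sup>2 + y\<^sup>2 - 2 * x * y * cos \<phi>) * sin \<phi> ^ (d - 2))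
     = sphere_weight d * (bessel_series d (x\<^sup>2) * bessel_series d (y\<^sup>2))"
proof -
  define B where "B = bessel_series d"
  obtain B1 B2 where 
    B: "\<And>t. (B has_real_derivative B1 t) (at t)"
    "\<And>t. (B1 has_real_derivative B2 t) (at t)"
    "\<And>t. isCont B2 t"
    "\<And>t. 4 * t * B2 t + 2 * real d * B1 t + B t = 0"
    using bessel_series_ode[OF assms(1)] unfolding B_def by blast
  have contB: "continuous_on UNIV B" "continuous_on UNIV B1" "continuous_on UNIV B2"
    using DERIV_isCont[OF B(1)] DERIV_isCont[OF B(2)] B(3) by (auto intro!: continuous_at_imp_continuous_on)
  note cont_intros = continuous_intros continuous_on_compose2[OF contB(1)] continuous_on_compose2[OF contB(2)] continuous_on_compose2[OF contB(3)]
  define I where "I = sphere_weight d"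
  define w where "w = (\<lambda>\<phi>::real. sin \<phi> ^ (d - 2))"
  define R where "R = (\<lambda>x \<phi>. x\<^sup>2 + y\<^sup>2 - 2 * x * y * cos \<phi> :: real)"
  define R1 where "R1 = (\<lambda>x \<phi>. 2 * x - 2 * y * cos \<phi> :: real)"
  define u where "u = (\<lambda>x. integral {0..pi} (\<lambda>\<phi>. B (R x \<phi>) * w \<phi>))"
  define u1 where "u1 = (\<lambda>x. integral {0..pi} (\<lambda>\<phi>. B1 (R x \<phi>) * R1 x \<phi> * w \<phi>))"
  define u2 where "u2 = (\<lambda>x. integral {0..pi} (\<lambda>\<phi>. (B2 (R x \<phi>) * (R1 x \<phi>)\<^sup>2 + 2 * B1 (R x \<phi>)) * w \<phi>))"
  have dR: "((\<lambda>x. R x \<phi>) has_real_derivative R1 x \<phi>) (at x)" for x \<phi>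
    unfolding R_def R1_def by (auto intro!: derivative_eq_intros)
  have dR1: "((\<lambda>x. R1 x \<phi>) has_real_derivative 2) (at x)" for x \<phi>
    unfolding R1_def by (auto intro!: derivative_eq_intros)
  have du: "(u has_real_derivative u1 x) (at x)" for x
  proof -
    have "((\<lambda>x. integral (cbox 0 pi) (\<lambda>\<phi>. B (R x \<phi>) * w \<phi>)) has_real_derivative integral (cbox 0 pi) (\<lambda>\<phi>. B1 (R x \<phi>) * R1 x \<phi> * w \<phi>)) (at x within UNIV)"
    proof (rule leibniz_rule_field_derivative)
      show "((\<lambda>x. B (R x \<phi>) * w \<phi>) has_real_derivative B1 (R x \<phi>) * R1 x \<phi> * w \<phi>) (at x)" for x \<phi>
        by (intro DERIV_cmult_right DERIV_chain2[OF B(1) dR])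
      show "(\<lambda>\<phi>. B (R x \<phi>) * w \<phi>) integrable_on cbox 0 pi" for x
        unfolding R_def w_def by (intro integrable_continuous cont_intros) auto
      show "continuous_on (UNIV \<times> cbox 0 pi) (\<lambda>(x, \<phi>). B1 (R x \<phi>) * R1 x \<phi> * w \<phi>)"
        unfolding R_def R1_def w_def case_prod_unfold by (intro cont_intros) auto
    qed auto
    then show ?thesis by (simp add: u_def[abs_def] u1_def)
  qed
  have du1: "(u1 has_real_derivative u2 x) (at x)" for x
  proof -
    have "((\<lambda>x. integral (cbox 0 pi) (\<lambda>\<phi>. B1 (R x \<phi>) * R1 x \<phi> * w \<phi>)) has_real_derivative integral (cbox 0 pi) (\<lambda>\<phi>. (B2 (R x \<phi>) * (R1 x \<phi>)\<^sup>2 + 2 * B1 (R x \<phi>)) * w \<phi>)) (at x within UNIV)"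
    proof (rule leibniz_rule_field_derivative)
      show "((\<lambda>x. B1 (R x \<phi>) * R1 x \<phi> * w \<phi>) has_real_derivative (B2 (R x \<phi>) * (R1 x \<phi>)\<^sup>2 + 2 * B1 (R x \<phi>)) * w \<phi>) (at x)" for x \<phi>
        using DERIV_cmult_right[OF DERIV_mult[OF DERIV_chain2[OF B(2) dR[of \<phi> x]] dR1[of \<phi> x]], of "w \<phi>"]
        by (simp add: power2_eq_square algebra_simps)
      show "(\<lambda>\<phi>. B1 (R x \<phi>) * R1 x \<phi> * w \<phi>) integrable_on cbox 0 pi" for x
        unfolding R_def R1_def w_def by (intro integrable_continuous cont_intros) auto
      show "continuous_on (UNIV \<times> cbox 0 pi) (\<lambda>(x, \<phi>). (B2 (R x \<phi>) * (R1 x \<phi>)\<^sup>2 + 2 * B1 (R x \<phi>)) * w \<phi>)"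
        unfolding R_def R1_def w_def case_prod_unfold by (intro cont_intros) auto
    qed auto
    then show ?thesis by (simp add: u1_def[abs_def] u2_def)
  qed
  have odd: "((\<lambda>\<phi>. cos \<phi> * w \<phi>) has_integral 0) {0..pi}"
  proof -
    have "((\<lambda>\<phi>. cos \<phi> * w \<phi>) has_integral (sin pi ^ (d - 1) / real (d - 1) - sin 0 ^ (d - 1) / real (d - 1))) {0..pi}"
    proof (rule fundamental_theorem_of_calculus)
      fix \<phi> :: real
      have "d - Suc (Suc 0) = d - 2" by simp
      then have "((\<lambda>\<phi>. sin \<phi> ^ (d - 1) / real (d - 1)) has_real_derivative cos \<phi> * w \<phi>) (at \<phi>)"
        using assms(1) unfolding w_def by (auto intro!: derivative_eq_intros)
      then show "((\<lambda>\<phi>. sin \<phi> ^ (d - 1) / real (d - 1)) has_vector_derivative cos \<phi> * w \<phi>) (at \<phi> within {0..pi})"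
        by (simp add: has_real_derivative_iff_has_vector_derivative has_vector_derivative_at_within)
    qed simp
    then show ?thesis using assms by (simp add: zero_power)
  qed
  \<comment> \<open>The angular part of the Laplacian is the total derivative \<open>T'\<close> below, so it integrates to zero.\<close>
  have ode: "x\<^sup>2 * u2 x + (real d - 1) * x * u1 x + x\<^sup>2 * u x = 0" for x
  proof -
    define T where "T = (\<lambda>\<phi>. B1 (R x \<phi>) * (2 * x * y) * sin \<phi> ^ (d - 1))"
    define T' where "T' = (\<lambda>\<phi>. B2 (R x \<phi>) * (2 * x * y)\<^sup>2 * (sin \<phi>)\<^sup>2 * w \<phi> + B1 (R x \<phi>) * (2 * x * y) * (real d - 1) * cos \<phi> * w \<phi>)"
    have "(T' has_integral (T pi - T 0)) {0..pi}"
    proof (rule fundamental_theorem_of_calculus)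
      fix \<phi> :: real
      have "((\<lambda>\<phi>. R x \<phi>) has_real_derivative 2 * x * y * sin \<phi>) (at \<phi>)"
        unfolding R_def by (auto intro!: derivative_eq_intros)
      note 1 = DERIV_chain2[OF B(2) this]
      have "d - 1 = Suc (d - 2)" using assms by simp
      then have 2: "((\<lambda>\<phi>. sin \<phi> ^ (d - 1)) has_real_derivative (real d - 1) * w \<phi> * cos \<phi>) (at \<phi>)" "sin \<phi> ^ (d - 1) = sin \<phi> * w \<phi>"
        using DERIV_power[OF DERIV_sin, of "d - 1" \<phi>] assms(1) by (auto simp: w_def of_nat_diff mult_ac)
      have "(T has_real_derivative T' \<phi>) (at \<phi>)"
        unfolding T_def T'_def
        using DERIV_mult[OF DERIV_cmult_right[OF 1, of "2 * x * y"] 2(1)]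
        by (rule back_subst[of "\<lambda>z. (_ has_real_derivative z) (at \<phi>)"]) (simp add: 2(2)[simplified] power2_eq_square algebra_simps)
      then show "(T has_vector_derivative T' \<phi>) (at \<phi> within {0..pi})"
        by (simp add: has_real_derivative_iff_has_vector_derivative has_vector_derivative_at_within)
    qed simp
    then have T0: "(T' has_integral 0) {0..pi}" using assms by (simp add: T_def zero_power)
    have i: "((\<lambda>\<phi>. (B2 (R x \<phi>) * (R1 x \<phi>)\<^sup>2 + 2 * B1 (R x \<phi>)) * w \<phi>) has_integral u2 x) {0..pi}"
       "((\<lambda>\<phi>. B1 (R x \<phi>) * R1 x \<phi> * w \<phi>) has_integral u1 x) {0..pi}"
       "((\<lambda>\<phi>. B (R x \<phi>) * w \<phi>) has_integral u x) {0..pi}"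
      unfolding u_def u1_def u2_def R_def R1_def w_def
      by (intro integrable_integral integrable_continuous_interval cont_intros; simp)+
    have "((\<lambda>\<phi>. x\<^sup>2 * ((B2 (R x \<phi>) * (R1 x \<phi>)\<^sup>2 + 2 * B1 (R x \<phi>)) * w \<phi>) + (real d - 1) * x * (B1 (R x \<phi>) * R1 x \<phi> * w \<phi>)
        + x\<^sup>2 * (B (R x \<phi>) * w \<phi>) + T' \<phi>) has_integral (x\<^sup>2 * u2 x + (real d - 1) * x * u1 x + x\<^sup>2 * u x + 0)) {0..pi}"
      by (intro has_integral_add has_integral_mult_right i T0)
    moreover have "x\<^sup>2 * ((B2 (R x \<phi>) * (R1 x \<phi>)\<^sup>2 + 2 * B1 (R x \<phi>)) * w \<phi>) + (real d - 1) * x * (B1 (R x \<phi>) * R1 x \<phi> * w \<phi>)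
        + x\<^sup>2 * (B (R x \<phi>) * w \<phi>) + T' \<phi> = 0" for \<phi>
    proof -
      \<comment> \<open>R is the squared distance of two points, and its squared gradient 4 R splits
        into the radial part R1^2 and the angular part (2 y sin phi)^2. This brings the integrand to
        the equation for B at R.\<close>
      have "(R1 x \<phi>)\<^sup>2 + 4 * y\<^sup>2 * (sin \<phi>)\<^sup>2 = 4 * R x \<phi>"
        unfolding R_def R1_def sin_squared_eq by (simp add: power2_eq_square algebra_simps)
      then have r: "(R1 x \<phi>)\<^sup>2 = 4 * R x \<phi> - 4 * y\<^sup>2 * (sin \<phi>)\<^sup>2" by linarith
      have "x\<^sup>2 * ((B2 (R x \<phi>) * (R1 x \<phi>)\<^sup>2 + 2 * B1 (R x \<phi>)) * w \<phi>) + (real d - 1) * x * (B1 (R x \<phi>) * R1 x \<phi> * w \<phi>)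
        + x\<^sup>2 * (B (R x \<phi>) * w \<phi>) + T' \<phi> = x\<^sup>2 * w \<phi> * (4 * R x \<phi> * B2 (R x \<phi>) + 2 * real d * B1 (R x \<phi>) + B (R x \<phi>))"
        unfolding T'_def r by (simp add: R1_def algebra_simps power2_eq_square)
      then show ?thesis using B(4)[of "R x \<phi>"] by simp
    qed
    ultimately have "((\<lambda>\<phi>. 0) has_integral (x\<^sup>2 * u2 x + (real d - 1) * x * u1 x + x\<^sup>2 * u x + 0)) {0..pi}" by simp
    then show ?thesis using has_integral_unique[OF _ has_integral_0] by force
  qed
  define K where "K = I * B (y\<^sup>2)"
  define v where "v = (\<lambda>x. K * B (x\<^sup>2))"
  define v1 where "v1 = (\<lambda>x. K * (B1 (x\<^sup>2) * (2 * x)))"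
  define v2 where "v2 = (\<lambda>x. K * (B2 (x\<^sup>2) * (2 * x)\<^sup>2 + 2 * B1 (x\<^sup>2)))"
  have sq: "((\<lambda>x. x\<^sup>2) has_real_derivative 2 * x) (at x)" "((\<lambda>x. 2 * x) has_real_derivative 2) (at x)" for x :: real
    by (auto intro!: derivative_eq_intros)
  have dv: "(v has_real_derivative v1 x) (at x)" for x
    unfolding v_def v1_def by (intro DERIV_cmult DERIV_chain2[OF B(1)] sq)
  have dv1: "(v1 has_real_derivative v2 x) (at x)" for x
    unfolding v1_def v2_def using DERIV_cmult[OF DERIV_mult[OF DERIV_chain2[OF B(2) sq(1)] sq(2)], of K x]
    by (simp add: power2_eq_square algebra_simps)
  have ode': "x\<^sup>2 * v2 x + (real d - 1) * x * v1 x + x\<^sup>2 * v x = 0" for x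
  proof -
    have "x\<^sup>2 * v2 x + (real d - 1) * x * v1 x + x\<^sup>2 * v x = x\<^sup>2 * K * (4 * x\<^sup>2 * B2 (x\<^sup>2) + 2 * real d * B1 (x\<^sup>2) + B (x\<^sup>2))"
      by (simp add: v_def v1_def v2_def power2_eq_square algebra_simps)
    then show ?thesis using B(4) by simp
  qed
  have init: "u 0 = v 0" "u1 0 = 0" "v1 0 = 0"
  proof -
    show "u 0 = v 0" by (simp add: u_def v_def R_def K_def I_def sphere_weight_def w_def B_def)
    have "u1 0 = integral {0..pi} (\<lambda>\<phi>. (- 2 * y * B1 (y\<^sup>2)) * (cos \<phi> * w \<phi>))"
      by (simp add: u1_def R_def R1_def mult_ac)
    also have "\<dots> = 0" using integral_unique[OF has_integral_mult_right[OF odd]] by simp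
    finally show "u1 0 = 0" .
  qed (simp add: v1_def)
  define e where "e = (\<lambda>x. (u x - v x)\<^sup>2 + (u1 x - v1 x)\<^sup>2)"
  have "e x \<le> e 0"
  proof (rule DERIV_nonpos_imp_nonincreasing[OF assms(2)])
    fix t :: real assume t: "0 \<le> t" "t \<le> x"
    have de: "(e has_real_derivative 2 * (u t - v t) * (u1 t - v1 t) + 2 * (u1 t - v1 t) * (u2 t - v2 t)) (at t)"
      unfolding e_def by (auto intro!: derivative_eq_intros du dv du1 dv1 simp: algebra_simps)
    \<comment> \<open>Multiplying by t^2 lets both equations be inserted and leaves -2 (d - 1) t (u1
      - v1)^2. At t = 0 the expression vanishes because u1 and v1 do.\<close>
    have le: "2 * (u t - v t) * (u1 t - v1 t) + 2 * (u1 t - v1 t) * (u2 t - v2 t) \<le> 0"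
    proof (cases "t = 0")
      case False
      then have t0: "t > 0" using t by simp
      have "t\<^sup>2 * (2 * (u t - v t) * (u1 t - v1 t) + 2 * (u1 t - v1 t) * (u2 t - v2 t))
         = 2 * (u1 t - v1 t) * ((t\<^sup>2 * u2 t + (real d - 1) * t * u1 t + t\<^sup>2 * u t) - (t\<^sup>2 * v2 t + (real d - 1) * t * v1 t + t\<^sup>2 * v t))
           - 2 * (real d - 1) * t * (u1 t - v1 t)\<^sup>2"
        by (simp add: algebra_simps power2_eq_square)
      also have "\<dots> \<le> 0" unfolding ode ode' using t assms by simp
      finally show ?thesis using t0 by (simp add: mult_le_0_iff)
    qed (simp add: init)
    show "\<exists>z. (e has_real_derivative z) (at t) \<and> z \<le> 0" using de le by blast
  qed
  also have "e 0 = 0" by (simp add: e_def init)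
  finally have "u x = v x" unfolding e_def by (simp add: sum_power2_le_zero_iff)
  then show ?thesis by (simp add: u_def v_def R_def K_def I_def w_def B_def mult_ac)
qed

section \<open>Gaussian moments and the Gaussian average of j\<close>

definition gauss_moment :: "nat \<Rightarrow> real" where
  "gauss_moment m = (LINT r|lborel. indicator {0..} r *\<^sub>R (exp (- r\<^sup>2) * r ^ m))"

text \<open>The recursion is what integration by parts would give; here it is read off from the
  closed forms for even and odd exponents.\<close>

lemma gauss_moment:
  shows has_bochner_integral_gauss_moment: "has_bochner_integral lborel (\<lambda>r. indicator {0..} r *\<^sub>R (exp (- r\<^sup>2) * r ^ m)) (gauss_moment m)"
    and gauss_moment_pos: "gauss_moment m > 0"
    and gauss_moment_Suc_Suc: "gauss_moment (Suc (Suc m)) = (real m + 1) / 2 * gauss_moment m"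
proof -
  have even: "gauss_moment (2 * k) = sqrt pi / 2 * (fact (2 * k) / (2 ^ (2 * k) * fact k))" for k
    unfolding gauss_moment_def by (rule has_bochner_integral_integral_eq[OF gaussian_moment_even_pos])
  have odd: "gauss_moment (2 * k + 1) = fact k / 2" for k
    unfolding gauss_moment_def by (rule has_bochner_integral_integral_eq[OF gaussian_moment_odd_pos])
  consider k where "m = 2 * k" | k where "m = 2 * k + 1" by (metis oddE evenE)
  then have "has_bochner_integral lborel (\<lambda>r. indicator {0..} r *\<^sub>R (exp (- r\<^sup>2) * r ^ m)) (gauss_moment m)
     \<and> gauss_moment m > 0 \<and> gauss_moment (Suc (Suc m)) = (real m + 1) / 2 * gauss_moment m"
  proof cases
    case 1
    have "Suc (Suc m) = 2 * Suc k" using 1 by simp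
    then have "gauss_moment (Suc (Suc m)) = sqrt pi / 2 * (fact (2 * Suc k) / (2 ^ (2 * Suc k) * fact (Suc k)))"
      by (simp only: even)
    also have "fact (2 * Suc k) / (2 ^ (2 * Suc k) * fact (Suc k)) = (real m + 1) / 2 * (fact (2 * k) / (2 ^ (2 * k) * fact k))"
      using 1 by (simp add: divide_simps del: power_mult) (simp add: algebra_simps)
    finally show ?thesis
      using gaussian_moment_even_pos[of k] unfolding 1 even by simp
  next
    case 2
    have "Suc (Suc m) = 2 * Suc k + 1" using 2 by simp
    then have "gauss_moment (Suc (Suc m)) = fact (Suc k) / 2" by (simp only: odd)
    then show ?thesis
      using gaussian_moment_odd_pos[of k] unfolding 2 odd by (simp add: algebra_simps)
  qed
  then show "has_bochner_integral lborel (\<lambda>r. indicator {0..} r *\<^sub>R (exp (- r\<^sup>2) * r ^ m)) (gauss_moment m)"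
    "gauss_moment m > 0" "gauss_moment (Suc (Suc m)) = (real m + 1) / 2 * gauss_moment m" by auto
qed

text \<open>The radial profile of exp(-|x|^2) in dimension d, including the Jacobian r^(d - 1) but
  not the surface area of the sphere.\<close>

definition gauss_kernel :: "nat \<Rightarrow> real \<Rightarrow> real" where
  "gauss_kernel d r = indicator {0..} r * (exp (- r\<^sup>2) * r ^ (d - 1))"

lemma gauss_kernel_nonneg: "gauss_kernel d r \<ge> 0"
  by (simp add: gauss_kernel_def indicator_def)

lemma integrable_gauss_kernel: "integrable lborel (gauss_kernel d)"
  using has_bochner_integral_gauss_moment[of "d - 1"]
  by (auto simp: gauss_kernel_def[abs_def] has_bochner_integral_iff)

lemma borel_measurable_gauss_kernel [measurable]: "gauss_kernel d \<in> borel_measurable borel"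
  unfolding gauss_kernel_def[abs_def] by measurable

lemma gauss_moment_pochhammer:
  assumes "d > 0"
  shows "gauss_moment (2 * k + (d - 1)) = pochhammer (real d / 2) k * gauss_moment (d - 1)"
proof (induction k)
  case (Suc k)
  have "2 * Suc k + (d - 1) = Suc (Suc (2 * k + (d - 1)))" by simp
  then have "gauss_moment (2 * Suc k + (d - 1)) = (real (2 * k + (d - 1)) + 1) / 2 * gauss_moment (2 * k + (d - 1))"
    by (simp only: gauss_moment_Suc_Suc)
  also have "(real (2 * k + (d - 1)) + 1) / 2 = real d / 2 + real k"
    using assms by (simp add: of_nat_diff field_simps)
  finally show ?case unfolding Suc by (simp add: pochhammer_rec' mult_ac)
qed simp

text \<open>The radial form of the fact that the Fourier transform of a Gaussian is a Gaussian.
  Integrating term by term, the Pochhammer symbol of the moment cancels the one in the coefficient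
  and leaves the series of exp(-c/4). It is the source of all positivity below, since j itself
  oscillates.\<close>

lemma bessel_series_gauss_integral:
  assumes "d \<ge> 2"
  shows "(LINT r|lborel. bessel_series d (r\<^sup>2 * c) * gauss_kernel d r) = gauss_moment (d - 1) * exp (- c / 4)"
proof -
  have "d > 0" using assms by simp
  define f where "f = (\<lambda>k r. (bessel_coeff d k * c ^ k) * (indicator {0..} r *\<^sub>R (exp (- r\<^sup>2) * r ^ (2 * k + (d - 1)))))"
  define M where "M = gauss_moment (d - 1)"
  have f_eq: "f k r = (bessel_coeff d k * (r\<^sup>2 * c) ^ k) * gauss_kernel d r" for k r
    by (simp add: f_def gauss_kernel_def power_add power_mult power_mult_distrib)
  have f_hb: "has_bochner_integral lborel (f k) ((bessel_coeff d k * c ^ k) * gauss_moment (2 * k + (d - 1)))" for k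
    unfolding f_def by (intro has_bochner_integral_mult_right has_bochner_integral_gauss_moment)
  have coeff: "bessel_coeff d k * c ^ k * gauss_moment (2 * k + (d - 1)) = M * ((- c / 4) ^ k /\<^sub>R fact k)" for k
  proof -
    have p: "pochhammer (real d / 2) k > 0" using assms by (intro pochhammer_pos) auto
    have "(- 1 / 4) ^ k * c ^ k = (- c / 4) ^ k" by (simp only: power_mult_distrib[symmetric]) simp
    then show ?thesis
      unfolding bessel_coeff_altdef[OF \<open>d > 0\<close>] gauss_moment_pochhammer[OF \<open>d > 0\<close>] M_def
      using p by (simp add: field_simps)
  qed
  have norm_int: "(LINT r|lborel. norm (f k r)) = M * ((\<bar>c\<bar> / 4) ^ k /\<^sub>R fact k)" for k
  proof -
    have "(LINT r|lborel. norm (f k r)) = (LINT r|lborel. \<bar>bessel_coeff d k * c ^ k\<bar> * (indicator {0..} r *\<^sub>R (exp (- r\<^sup>2) * r ^ (2 * k + (d - 1)))))"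
      by (intro Bochner_Integration.integral_cong refl) (simp add: f_def abs_mult indicator_def)
    also have "\<dots> = \<bar>bessel_coeff d k * c ^ k\<bar> * gauss_moment (2 * k + (d - 1))"
      by (intro has_bochner_integral_integral_eq has_bochner_integral_mult_right has_bochner_integral_gauss_moment)
    also have "\<dots> = \<bar>bessel_coeff d k * c ^ k * gauss_moment (2 * k + (d - 1))\<bar>"
      using gauss_moment_pos[of "2 * k + (d - 1)"] by (simp add: abs_mult)
    also have "\<dots> = M * ((\<bar>c\<bar> / 4) ^ k /\<^sub>R fact k)"
      unfolding coeff using gauss_moment_pos[of "d - 1"] by (simp add: abs_mult power_abs M_def)
    finally show ?thesis .
  qed
  have "(LINT r|lborel. (\<Sum>k. f k r)) = (\<Sum>k. LINT r|lborel. f k r)"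
  proof (rule integral_suminf)
    show "integrable lborel (f k)" for k using f_hb[of k] by (simp add: has_bochner_integral_iff)
    show "AE r in lborel. summable (\<lambda>k. norm (f k r))"
    proof (rule AE_I2)
      fix r
      have "summable (\<lambda>k. norm (bessel_coeff d k * (r\<^sup>2 * c) ^ k) * \<bar>gauss_kernel d r\<bar>)"
        by (intro summable_mult2 summable_bessel_series assms)
      then show "summable (\<lambda>k. norm (f k r))" unfolding f_eq by (simp add: abs_mult)
    qed
    show "summable (\<lambda>k. LINT r|lborel. norm (f k r))"
      unfolding norm_int by (intro summable_mult summable_exp_generic)
  qed
  also have "(\<lambda>r. \<Sum>k. f k r) = (\<lambda>r. bessel_series d (r\<^sup>2 * c) * gauss_kernel d r)"
  proof
    fix r
    have "summable (\<lambda>k. bessel_coeff d k * (r\<^sup>2 * c) ^ k)"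
      by (rule summable_norm_cancel, rule summable_bessel_series[OF assms])
    from suminf_mult2[OF this, of "gauss_kernel d r"]
    show "(\<Sum>k. f k r) = bessel_series d (r\<^sup>2 * c) * gauss_kernel d r"
      unfolding f_eq bessel_series_def by simp
  qed
  also have "(\<Sum>k. LINT r|lborel. f k r) = (\<Sum>k. M * ((- c / 4) ^ k /\<^sub>R fact k))"
    using f_hb by (simp only: has_bochner_integral_iff coeff)
  also have "\<dots> = M * exp (- c / 4)"
    unfolding exp_def by (intro suminf_mult summable_exp_generic)
  finally show ?thesis by (simp only: M_def)
qed

subsection \<open>Positivity of the constant\<close>

text \<open>
  Up to a constant this is the density at distance $\sqrt t$ from the origin of the random walk with
  $m$ unit steps, smoothed by a Gaussian of width about $1/\sigma$.
\<close>

definition walk_transform :: "nat \<Rightarrow> real \<Rightarrow> nat \<Rightarrow> real \<Rightarrow> real" where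
  "walk_transform d \<sigma> m t =
     (LINT r|lborel. bessel_series d ((\<sigma> * r)\<^sup>2 * t) * bessel_series d ((\<sigma> * r)\<^sup>2) ^ m * gauss_kernel d r)"

lemma abs_bessel_series_le_1:
  assumes "d \<ge> 3" "t \<ge> 0"
  shows "\<bar>bessel_series d t\<bar> \<le> 1"
  using bessel_series_abs_le_1[OF assms(1), of "sqrt t"] assms(2) by simp

lemma continuous_on_bessel_series:
  assumes "d \<ge> 2"
  shows "continuous_on A (bessel_series d)"
  using isCont_bessel_series[OF assms] by (intro continuous_at_imp_continuous_on) auto

lemma sphere_weight_pos:
  assumes "d \<ge> 2"
  shows "sphere_weight d > 0"
proof -
  have "integral {0..pi} (\<lambda>\<phi>. 0) < sphere_weight d"
    unfolding sphere_weight_def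
  proof (rule integral_less_real)
    show "continuous_on {0..pi} (\<lambda>\<phi>. sin \<phi> ^ (d - 2))" by (intro continuous_intros)
    show "{0<..<pi} \<noteq> {}" using pi_gt_zero by (simp add: not_le)
    show "0 < sin \<phi> ^ (d - 2)" if "\<phi> \<in> {0<..<pi}" for \<phi> using that by (simp add: sin_gt_zero)
  qed auto
  then show ?thesis by simp
qed

text \<open>One step of the walk: Fubini, followed by the product formula at sigma r a and sigma r,
  merges the averaged factor into j(sigma r a) and one more factor j(sigma r).\<close>

lemma walk_transform_Suc:
  fixes m :: nat
  assumes d: "d \<ge> 3" and "\<sigma> \<ge> 0" "a \<ge> 0"
  defines "f \<equiv> \<lambda>\<phi>. indicator {0..pi} \<phi> * sin \<phi> ^ (d - 2) * walk_transform d \<sigma> m (a\<^sup>2 + 1 - 2 * a * cos \<phi>)"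
  shows "integrable lborel f" and "(LINT \<phi>|lborel. f \<phi>) = sphere_weight d * walk_transform d \<sigma> (Suc m) (a\<^sup>2)"
proof -
  have d2: "d \<ge> 2" using d by simp
  define B where "B = bessel_series d"
  define R where "R = (\<lambda>\<phi>. a\<^sup>2 + 1 - 2 * a * cos \<phi>)"
  have R: "R \<phi> \<ge> 0" for \<phi>
  proof -
    have "2 * a * cos \<phi> \<le> 2 * a * 1" using assms by (intro mult_left_mono) auto
    then have "(a - 1)\<^sup>2 \<le> R \<phi>" by (simp add: R_def power2_eq_square algebra_simps)
    then show ?thesis using zero_le_power2[of "a - 1"] by linarith
  qed
  have B_le: "\<bar>B t\<bar> \<le> 1" if "t \<ge> 0" for t
    using abs_bessel_series_le_1[OF d that] by (simp add: B_def)
  have [measurable]: "B \<in> borel_measurable borel"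
    unfolding B_def by (intro borel_measurable_continuous_onI continuous_on_bessel_series d2)
  have [measurable]: "R \<in> borel_measurable borel"
    unfolding R_def by (intro borel_measurable_continuous_onI continuous_intros)
  have [measurable]: "(\<lambda>\<phi>::real. sin \<phi> ^ (d - 2)) \<in> borel_measurable borel"
    by (intro borel_measurable_continuous_onI continuous_intros)
  define k where "k = (\<lambda>r. B ((\<sigma> * r)\<^sup>2) ^ m * gauss_kernel d r)"
  have [measurable]: "k \<in> borel_measurable borel" unfolding k_def by measurable
  define g where "g = (\<lambda>\<phi> r. indicator {0..pi} \<phi> * sin \<phi> ^ (d - 2) * (B ((\<sigma> * r)\<^sup>2 * R \<phi>) * k r))"
  \<comment> \<open>A majorant for Fubini: j, its powers and the sine weight are all bounded by
    1.\<close>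
  have bound: "integrable (lborel \<Otimes>\<^sub>M lborel) (\<lambda>(\<phi>, r). indicator {0..pi} \<phi> * gauss_kernel d r :: real)"
  proof (rule lborel_pair.Fubini_integrable)
    show "(\<lambda>(\<phi>, r). indicator {0..pi} \<phi> * gauss_kernel d r) \<in> borel_measurable (lborel \<Otimes>\<^sub>M lborel)"
      by measurable
    have "integrable lborel (\<lambda>x::real. indicator {0..pi} x * (LINT y|lborel. gauss_kernel d y))"
      by (intro integrable_mult_left) simp
    moreover have "(LINT y|lborel. norm (case (x, y) of (\<phi>, r) \<Rightarrow> indicator {0..pi} \<phi> * gauss_kernel d r)) = indicator {0..pi} x * (LINT y|lborel. gauss_kernel d y)" for x
      by (simp add: abs_mult gauss_kernel_nonneg)
    ultimately show "integrable lborel (\<lambda>x. LINT y|lborel. norm (case (x, y) of (\<phi>, r) \<Rightarrow> indicator {0..pi} \<phi> * gauss_kernel d r))"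
      by simp
    show "AE x in lborel. integrable lborel (\<lambda>y. case (x, y) of (\<phi>, r) \<Rightarrow> indicator {0..pi} \<phi> * gauss_kernel d r)"
      using integrable_gauss_kernel by (intro AE_I2) simp
  qed
  have int_g: "integrable (lborel \<Otimes>\<^sub>M lborel) (\<lambda>(\<phi>, r). g \<phi> r)"
  proof (rule Bochner_Integration.integrable_bound[OF bound])
    show "(\<lambda>(\<phi>, r). g \<phi> r) \<in> borel_measurable (lborel \<Otimes>\<^sub>M lborel)"
      unfolding g_def by measurable
    show "AE x in lborel \<Otimes>\<^sub>M lborel. norm (case x of (\<phi>, r) \<Rightarrow> g \<phi> r) \<le> norm (case x of (\<phi>, r) \<Rightarrow> indicator {0..pi} \<phi> * gauss_kernel d r)"
    proof (rule AE_I2, clarify)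
      fix \<phi> r :: real
      have "\<bar>sin \<phi> ^ (d - 2)\<bar> \<le> 1" by (simp add: power_abs power_le_one)
      moreover have "\<bar>B ((\<sigma> * r)\<^sup>2 * R \<phi>)\<bar> \<le> 1" using R by (intro B_le) auto
      moreover have "\<bar>B ((\<sigma> * r)\<^sup>2) ^ m\<bar> \<le> 1" unfolding power_abs by (intro power_le_one B_le) auto
      ultimately have "\<bar>sin \<phi> ^ (d - 2)\<bar> * (\<bar>B ((\<sigma> * r)\<^sup>2 * R \<phi>)\<bar> * (\<bar>B ((\<sigma> * r)\<^sup>2) ^ m\<bar> * gauss_kernel d r)) \<le> 1 * (1 * (1 * gauss_kernel d r))"
        using gauss_kernel_nonneg[of d r] by (intro mult_mono) auto
      then show "norm (g \<phi> r) \<le> norm (indicator {0..pi} \<phi> * gauss_kernel d r :: real)"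
        using gauss_kernel_nonneg[of d r] by (auto simp: g_def k_def abs_mult indicator_def)
    qed
  qed
  have f_g: "f \<phi> = (LINT r|lborel. g \<phi> r)" for \<phi>
    by (simp add: f_def g_def k_def B_def R_def walk_transform_def mult.assoc)
  show "integrable lborel f"
    using lborel_pair.integrable_fst'[OF int_g] by (simp add: f_g[abs_def])
  have inner: "(LINT \<phi>|lborel. g \<phi> r) = sphere_weight d * (B ((\<sigma> * r)\<^sup>2 * a\<^sup>2) * B ((\<sigma> * r)\<^sup>2) * k r)" for r
  proof (cases "r \<ge> 0")
    case False
    then have "k r = 0" by (simp add: k_def gauss_kernel_def)
    then show ?thesis by (simp add: g_def)
  next
    case True
    define x y where "x = \<sigma> * r * a" "y = \<sigma> * r"
    have xy: "x \<ge> 0" "(\<sigma> * r)\<^sup>2 * R \<phi> = x\<^sup>2 + y\<^sup>2 - 2 * x * y * cos \<phi>" for \<phi>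
      using assms True by (auto simp: x_y_def R_def power2_eq_square algebra_simps)
    have cont: "continuous_on {0..pi} (\<lambda>\<phi>. B (x\<^sup>2 + y\<^sup>2 - 2 * x * y * cos \<phi>) * sin \<phi> ^ (d - 2))"
      unfolding B_def by (intro continuous_intros continuous_on_compose2[OF continuous_on_bessel_series[OF d2, of UNIV]]) auto
    have "(LINT \<phi>|lborel. g \<phi> r) = (LINT \<phi>:{0..pi}|lborel. B (x\<^sup>2 + y\<^sup>2 - 2 * x * y * cos \<phi>) * sin \<phi> ^ (d - 2)) * k r"
      unfolding set_lebesgue_integral_def integral_mult_left_zero[symmetric] xy(2)[symmetric]
      by (intro Bochner_Integration.integral_cong refl) (simp add: g_def mult_ac)
    also have "(LINT \<phi>:{0..pi}|lborel. B (x\<^sup>2 + y\<^sup>2 - 2 * x * y * cos \<phi>) * sin \<phi> ^ (d - 2)) = sphere_weight d * (B (x\<^sup>2) * B (y\<^sup>2))"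
      unfolding set_borel_integral_eq_integral(2)[OF borel_integrable_atLeastAtMost'[OF cont]]
      unfolding B_def by (rule bessel_product_formula[OF d2 xy(1)])
    finally show ?thesis by (simp add: x_y_def power_mult_distrib mult.assoc)
  qed
  have "(LINT \<phi>|lborel. f \<phi>) = (LINT r|lborel. LINT \<phi>|lborel. g \<phi> r)"
    unfolding f_g by (rule lborel_pair.Fubini_integral[OF int_g, symmetric])
  also have "\<dots> = sphere_weight d * walk_transform d \<sigma> (Suc m) (a\<^sup>2)"
    unfolding inner walk_transform_def by (simp add: B_def k_def mult_ac)
  finally show "(LINT \<phi>|lborel. f \<phi>) = sphere_weight d * walk_transform d \<sigma> (Suc m) (a\<^sup>2)" .
qed

section \<open>Nonnegativity and lower bounds for the smoothed walk\<close>

lemma walk_transform_0: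
  assumes "d \<ge> 3"
  shows "walk_transform d \<sigma> 0 t = gauss_moment (d - 1) * exp (- (\<sigma>\<^sup>2 * t) / 4)"
  using bessel_series_gauss_integral[of d "\<sigma>\<^sup>2 * t"] assms
  by (simp add: walk_transform_def power_mult_distrib mult_ac)

text \<open>Invisible in the oscillating defining integral, but clear from the recursion: it starts
  with a Gaussian and averages with nonnegative weights.\<close>

lemma walk_transform_nonneg:
  assumes "d \<ge> 3" "\<sigma> \<ge> 0" "t \<ge> 0"
  shows "walk_transform d \<sigma> m t \<ge> 0"
  using assms(3)
proof (induction m arbitrary: t)
  case 0
  then show ?case using gauss_moment_pos[of "d - 1"] by (simp add: walk_transform_0[OF assms(1)])
next
  case (Suc m)
  define a where "a = sqrt t"
  have a: "a \<ge> 0" "a\<^sup>2 = t" using Suc.prems by (auto simp: a_def)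
  have "0 \<le> (LINT \<phi>|lborel. indicator {0..pi} \<phi> * sin \<phi> ^ (d - 2) * walk_transform d \<sigma> m (a\<^sup>2 + 1 - 2 * a * cos \<phi>))"
  proof (rule Bochner_Integration.integral_nonneg)
    fix \<phi> :: real
    have "2 * a * cos \<phi> \<le> 2 * a * 1" using a by (intro mult_left_mono) auto
    then have "(a - 1)\<^sup>2 \<le> a\<^sup>2 + 1 - 2 * a * cos \<phi>" by (simp add: power2_eq_square algebra_simps)
    then have "0 \<le> a\<^sup>2 + 1 - 2 * a * cos \<phi>" using zero_le_power2[of "a - 1"] by linarith
    from Suc.IH[OF this] show "0 \<le> indicator {0..pi} \<phi> * sin \<phi> ^ (d - 2) * walk_transform d \<sigma> m (a\<^sup>2 + 1 - 2 * a * cos \<phi>)"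
      by (auto simp: indicator_def sin_ge_zero)
  qed
  also have "\<dots> = sphere_weight d * walk_transform d \<sigma> (Suc m) (a\<^sup>2)"
    by (rule walk_transform_Suc[OF assms(1,2) a(1)])
  finally show ?case using sphere_weight_pos[of d] assms(1) by (simp add: a zero_le_mult_iff)
qed

text \<open>By nonnegativity the average over all angles may be cut down to a window [p, p'] on
  which the integrand is under control.\<close>

lemma walk_transform_Suc_ge:
  assumes "d \<ge> 3" "\<sigma> \<ge> 0" "a \<ge> 0" "0 \<le> p" "p \<le> p'" "p' \<le> pi" "0 \<le> \<kappa>" "0 \<le> s"
    and le: "\<And>\<phi>. p \<le> \<phi> \<Longrightarrow> \<phi> \<le> p' \<Longrightarrow> s \<le> sin \<phi> \<and> \<kappa> \<le> walk_transform d \<sigma> m (a\<^sup>2 + 1 - 2 * a * cos \<phi>)"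
  shows "s ^ (d - 2) * \<kappa> * (p' - p) / sphere_weight d \<le> walk_transform d \<sigma> (Suc m) (a\<^sup>2)"
proof -
  define f where "f = (\<lambda>\<phi>. indicator {0..pi} \<phi> * sin \<phi> ^ (d - 2) * walk_transform d \<sigma> m (a\<^sup>2 + 1 - 2 * a * cos \<phi>))"
  note f = walk_transform_Suc[OF assms(1,2,3), of m, folded f_def]
  have "(s ^ (d - 2) * \<kappa>) * (p' - p) = (LINT \<phi>|lborel. (s ^ (d - 2) * \<kappa>) * indicator {p..p'} \<phi>)"
    using assms(5) by simp
  also have "\<dots> \<le> (LINT \<phi>|lborel. f \<phi>)"
  proof (rule integral_mono[OF _ f(1)])
    show "integrable lborel (\<lambda>\<phi>. s ^ (d - 2) * \<kappa> * indicator {p..p'} \<phi>)"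
      by (intro integrable_mult_right integrable_real_indicator) (auto simp: emeasure_lborel_Icc_eq)
    fix \<phi> :: real
    have "2 * a * cos \<phi> \<le> 2 * a * 1" using assms by (intro mult_left_mono) auto
    then have "(a - 1)\<^sup>2 \<le> a\<^sup>2 + 1 - 2 * a * cos \<phi>" by (simp add: power2_eq_square algebra_simps)
    then have "0 \<le> a\<^sup>2 + 1 - 2 * a * cos \<phi>" using zero_le_power2[of "a - 1"] by linarith
    from walk_transform_nonneg[OF assms(1,2) this, of m]
    have nn: "0 \<le> f \<phi>" by (auto simp: f_def indicator_def sin_ge_zero)
    show "s ^ (d - 2) * \<kappa> * indicator {p..p'} \<phi> \<le> f \<phi>"
    proof (cases "\<phi> \<in> {p..p'}")
      case True
      then have "0 \<le> sin \<phi>" using assms(4,6) by (intro sin_ge_zero) auto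
      with True have "s ^ (d - 2) * \<kappa> \<le> sin \<phi> ^ (d - 2) * walk_transform d \<sigma> m (a\<^sup>2 + 1 - 2 * a * cos \<phi>)"
        using le[of \<phi>] assms by (intro mult_mono power_mono zero_le_power) auto
      then show ?thesis using True assms by (auto simp: f_def)
    qed (use nn in simp)
  qed
  also have "\<dots> = sphere_weight d * walk_transform d \<sigma> (Suc m) (a\<^sup>2)" by (rule f(2))
  finally show ?thesis using sphere_weight_pos[of d] assms(1) by (simp add: field_simps)
qed

text \<open>
  Read backwards from its end near the origin, the walk has its penultimate point near the unit sphere
  and all earlier points in the annulus of radii $1/2$ and $3/2$, which suffices to bound the density below.
\<close>

lemma walk_transform_1_ge:
  assumes d: "d \<ge> 3" and "0 < \<delta>" "\<delta> \<le> 1" "\<bar>a - 1\<bar> \<le> \<delta> / 2"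
  shows "(\<delta> / 16) ^ (d - 2) * (gauss_moment (d - 1) / 2) * (\<delta> / 4) / sphere_weight d \<le> walk_transform d (1 / \<delta>) 1 (a\<^sup>2)"
proof -
  define M where "M = gauss_moment (d - 1)"
  have M: "M > 0" using gauss_moment_pos by (simp add: M_def)
  have a: "0 \<le> a" "a \<le> 3 / 2" using assms by linarith+
  have "(\<delta> / 16) ^ (d - 2) * (M / 2) * (\<delta> / 2 - \<delta> / 4) / sphere_weight d \<le> walk_transform d (1 / \<delta>) (Suc 0) (a\<^sup>2)"
  proof (rule walk_transform_Suc_ge[OF d])
    have "pi > 3" by (rule pi_gt3)
    then show "\<delta> / 2 \<le> pi" using assms by linarith
    \<comment> \<open>Angles up to delta / 2 place the endpoint within distance delta of the origin,
      since (a - 1)^2 + 2 a (1 - cos phi) <= 5/8 delta^2; there the Gaussian of width delta is at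
      least 1/2. Angles from delta / 4 on keep sin phi >= delta / 16.\<close>
    fix \<phi> assume \<phi>: "\<delta> / 4 \<le> \<phi>" "\<phi> \<le> \<delta> / 2"
    show "\<delta> / 16 \<le> sin \<phi> \<and> M / 2 \<le> walk_transform d (1 / \<delta>) 0 (a\<^sup>2 + 1 - 2 * a * cos \<phi>)"
    proof
      have "\<phi> / 4 \<le> sin \<phi>" using \<phi> assms \<open>pi > 3\<close> by (intro sin_ge_quarter) auto
      then show "\<delta> / 16 \<le> sin \<phi>" using \<phi> by linarith
      have "cos \<phi> = 1 - 2 * (sin (\<phi> / 2))\<^sup>2" using cos_double_sin[of "\<phi> / 2"] by simp
      moreover have "(sin (\<phi> / 2))\<^sup>2 \<le> (\<phi> / 2)\<^sup>2"
        using abs_sin_x_le_abs_x[of "\<phi> / 2"] by (simp only: abs_le_square_iff)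
      ultimately have "1 - cos \<phi> \<le> \<phi>\<^sup>2 / 2" by (simp add: power_divide)
      moreover have "\<phi>\<^sup>2 \<le> (\<delta> / 2)\<^sup>2" using \<phi> assms by (intro power_mono) auto
      ultimately have "1 - cos \<phi> \<le> \<delta>\<^sup>2 / 8" by (simp add: power_divide)
      then have "a * (1 - cos \<phi>) \<le> 3 / 2 * (\<delta>\<^sup>2 / 8)" using a by (intro mult_mono) auto
      moreover have "(a - 1)\<^sup>2 \<le> (\<delta> / 2)\<^sup>2" using assms by (simp add: abs_le_square_iff[symmetric])
      moreover have "a\<^sup>2 + 1 - 2 * a * cos \<phi> = (a - 1)\<^sup>2 + 2 * (a * (1 - cos \<phi>))"
        by (simp add: power2_eq_square algebra_simps)
      ultimately have "a\<^sup>2 + 1 - 2 * a * cos \<phi> \<le> 5 / 8 * \<delta>\<^sup>2" by (simp add: power_divide)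
      then have "a\<^sup>2 + 1 - 2 * a * cos \<phi> \<le> \<delta>\<^sup>2" using zero_le_power2[of \<delta>] by linarith
      then have "(1 / \<delta>)\<^sup>2 * (a\<^sup>2 + 1 - 2 * a * cos \<phi>) \<le> 1"
        using assms by (simp add: power_divide)
      then have "1 / 2 \<le> exp (- ((1 / \<delta>)\<^sup>2 * (a\<^sup>2 + 1 - 2 * a * cos \<phi>)) / 4)"
        using exp_ge_add_one_self[of "- ((1 / \<delta>)\<^sup>2 * (a\<^sup>2 + 1 - 2 * a * cos \<phi>)) / 4"] by linarith
      then show "M / 2 \<le> walk_transform d (1 / \<delta>) 0 (a\<^sup>2 + 1 - 2 * a * cos \<phi>)"
        unfolding walk_transform_0[OF d] M_def[symmetric] using M mult_left_mono by fastforce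
    qed
  qed (use assms a M in auto)
  then show ?thesis by (simp add: M_def)
qed

text \<open>The angle with cosine a / 2 leads exactly to the unit sphere, because a^2 + 1 - 2 a (a /
  2) = 1. An angular window of width eta / 6 moves the squared distance by at most 2 (3/2) (eta / 6)
  = eta / 2, and |sqrt R - 1| <= |R - 1|.\<close>

lemma walk_transform_Suc_ge_near_1:
  assumes d: "d \<ge> 3" and "\<sigma> \<ge> 0" "1 / 2 \<le> a" "a \<le> 3 / 2" "0 < \<eta>" "\<eta> \<le> 1" "0 \<le> \<kappa>"
    and le: "\<And>b. \<bar>b - 1\<bar> \<le> \<eta> / 2 \<Longrightarrow> \<kappa> \<le> walk_transform d \<sigma> m (b\<^sup>2)"
  shows "(1 / 3) ^ (d - 2) * \<kappa> * (\<eta> / 6) / sphere_weight d \<le> walk_transform d \<sigma> (Suc m) (a\<^sup>2)"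
proof -
  define \<phi>0 where "\<phi>0 = arccos (a / 2)"
  have \<phi>0: "0 \<le> \<phi>0" "\<phi>0 \<le> pi / 2" "cos \<phi>0 = a / 2"
    using assms arccos_le_pi2[of "a / 2"] by (auto simp: \<phi>0_def intro!: arccos_lbound)
  have "pi > 3" by (rule pi_gt3)
  have "(1 / 3) ^ (d - 2) * \<kappa> * (\<phi>0 + \<eta> / 6 - \<phi>0) / sphere_weight d \<le> walk_transform d \<sigma> (Suc m) (a\<^sup>2)"
  proof (rule walk_transform_Suc_ge[OF d])
    show "\<phi>0 + \<eta> / 6 \<le> pi" using \<phi>0 assms \<open>pi > 3\<close> by linarith
    fix \<phi> assume \<phi>: "\<phi>0 \<le> \<phi>" "\<phi> \<le> \<phi>0 + \<eta> / 6"
    have "\<bar>cos \<phi> - cos \<phi>0\<bar> = 2 * \<bar>sin ((\<phi> + \<phi>0) / 2)\<bar> * \<bar>sin ((\<phi>0 - \<phi>) / 2)\<bar>"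
      by (simp add: cos_diff_cos abs_mult)
    also have "\<dots> \<le> 2 * 1 * \<bar>(\<phi>0 - \<phi>) / 2\<bar>"
      by (intro mult_mono abs_sin_x_le_abs_x) auto
    also have "\<dots> \<le> \<eta> / 6" using \<phi> by simp
    finally have c: "\<bar>cos \<phi> - a / 2\<bar> \<le> \<eta> / 6" unfolding \<phi>0(3) .
    \<comment> \<open>As a / 2 lies between 1/4 and 3/4, a deviation of at most 1/6 keeps the cosine
      in [0, 11/12]. Since 1 - 121/144 = 23/144 exceeds 1/9, the step is not nearly parallel to the
      radius.\<close>
    then have "0 \<le> cos \<phi>" "cos \<phi> \<le> 11 / 12" using assms by linarith+
    then have "(cos \<phi>)\<^sup>2 \<le> (11 / 12)\<^sup>2" by (intro power_mono)
    then have "(cos \<phi>)\<^sup>2 \<le> 121 / 144" by (simp add: power_divide)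
    then have "(1 / 3)\<^sup>2 \<le> (sin \<phi>)\<^sup>2" unfolding sin_squared_eq by (simp add: power_divide)
    moreover have "0 \<le> sin \<phi>" using \<phi> \<phi>0 assms \<open>pi > 3\<close> by (intro sin_ge_zero) linarith+
    ultimately have s: "1 / 3 \<le> sin \<phi>" by (rule power2_le_imp_le)
    define R where "R = a\<^sup>2 + 1 - 2 * a * cos \<phi>"
    have "2 * a * cos \<phi> \<le> 2 * a * 1" using assms by (intro mult_left_mono) auto
    then have "(a - 1)\<^sup>2 \<le> R" by (simp add: R_def power2_eq_square algebra_simps)
    then have R: "R \<ge> 0" using zero_le_power2[of "a - 1"] by linarith
    have "\<bar>R - 1\<bar> = 2 * a * \<bar>cos \<phi> - a / 2\<bar>"
    proof -
      have "R - 1 = - (2 * a * (cos \<phi> - a / 2))" by (simp add: R_def power2_eq_square algebra_simps)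
      then show ?thesis using assms by (simp only: abs_minus_cancel abs_mult)
    qed
    also have "\<dots> \<le> 2 * (3 / 2) * (\<eta> / 6)" using c assms by (intro mult_mono) auto
    finally have "\<bar>R - 1\<bar> \<le> \<eta> / 2" by simp
    moreover have "\<bar>sqrt R - 1\<bar> \<le> \<bar>R - 1\<bar>"
    proof -
      have "R - 1 = (sqrt R - 1) * (sqrt R + 1)" using R by (simp add: algebra_simps)
      then have "\<bar>R - 1\<bar> = \<bar>sqrt R - 1\<bar> * (sqrt R + 1)" using R by (simp add: abs_mult)
      moreover have "\<bar>sqrt R - 1\<bar> * 1 \<le> \<bar>sqrt R - 1\<bar> * (sqrt R + 1)"
        using R by (intro mult_left_mono) auto
      ultimately show ?thesis by simp
    qed
    ultimately have "\<kappa> \<le> walk_transform d \<sigma> m ((sqrt R)\<^sup>2)" by (intro le) linarith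
    then show "1 / 3 \<le> sin \<phi> \<and> \<kappa> \<le> walk_transform d \<sigma> m (a\<^sup>2 + 1 - 2 * a * cos \<phi>)"
      using s R by (simp add: R_def)
  qed (use assms \<phi>0 in auto)
  then show ?thesis by simp
qed

text \<open>The last step costs delta^(d - 2) through the sine and delta through its window; aiming
  the step before it at a shell of thickness of order delta costs one more. For any earlier step eta
  = 1 suffices, because the annulus with radii 1/2 and 3/2 is then its own target, so no further
  power of delta is lost.\<close>

lemma walk_transform_ge:
  assumes d: "d \<ge> 3" and "m \<ge> 2"
  shows "\<exists>c>0. \<forall>\<delta> a. 0 < \<delta> \<longrightarrow> \<delta> \<le> 1 \<longrightarrow> 1 / 2 \<le> a \<longrightarrow> a \<le> 3 / 2 \<longrightarrow> c * \<delta> ^ d \<le> walk_transform d (1 / \<delta>) m (a\<^sup>2)"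
  using assms(2)
proof (induction m rule: dec_induct)
  case base
  define M where "M = gauss_moment (d - 1)"
  have M: "M > 0" using gauss_moment_pos by (simp add: M_def)
  define I where "I = sphere_weight d"
  have I: "I > 0" using sphere_weight_pos[of d] d by (simp add: I_def)
  define c where "c = (1 / 3) ^ (d - 2) * ((1 / 16) ^ (d - 2) * (M / 2) * (1 / 4) / I) * (1 / 6) / I"
  have "c > 0" using M I by (simp add: c_def)
  moreover have "c * \<delta> ^ d \<le> walk_transform d (1 / \<delta>) 2 (a\<^sup>2)"
    if \<delta>: "0 < \<delta>" "\<delta> \<le> 1" and a: "1 / 2 \<le> a" "a \<le> 3 / 2" for \<delta> a :: real
  proof -
    have "(1 / 3) ^ (d - 2) * ((\<delta> / 16) ^ (d - 2) * (M / 2) * (\<delta> / 4) / I) * (\<delta> / 6) / I \<le> walk_transform d (1 / \<delta>) (Suc 1) (a\<^sup>2)"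
      unfolding I_def M_def
    proof (rule walk_transform_Suc_ge_near_1[OF d _ a \<delta> _ walk_transform_1_ge[OF d \<delta>]])
      show "0 \<le> (\<delta> / 16) ^ (d - 2) * (gauss_moment (d - 1) / 2) * (\<delta> / 4) / sphere_weight d"
        using M I \<delta> by (simp add: M_def I_def)
    qed (use \<delta> in auto)
    moreover have "(\<delta> / 16) ^ (d - 2) = (1 / 16) ^ (d - 2) * \<delta> ^ (d - 2)"
      by (simp only: power_mult_distrib[symmetric]) simp
    moreover have "\<delta> ^ d = \<delta> ^ (d - 2) * \<delta> * \<delta>"
    proof -
      have "d = Suc (Suc (d - 2))" using d by simp
      then show ?thesis by (metis power_Suc2)
    qed
    ultimately show ?thesis by (simp add: c_def mult_ac numeral_2_eq_2)
  qed
  ultimately show ?case by blast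
next
  case (step m)
  then obtain c where c: "c > 0" and le: "\<And>\<delta> a. 0 < \<delta> \<Longrightarrow> \<delta> \<le> 1 \<Longrightarrow> 1 / 2 \<le> a \<Longrightarrow> a \<le> 3 / 2 \<Longrightarrow> c * \<delta> ^ d \<le> walk_transform d (1 / \<delta>) m (a\<^sup>2)"
    by blast
  define I where "I = sphere_weight d"
  have I: "I > 0" using sphere_weight_pos[of d] d by (simp add: I_def)
  define c' where "c' = (1 / 3) ^ (d - 2) * c * (1 / 6) / I"
  have "c' > 0" using c I by (simp add: c'_def)
  moreover have "c' * \<delta> ^ d \<le> walk_transform d (1 / \<delta>) (Suc m) (a\<^sup>2)"
    if \<delta>: "0 < \<delta>" "\<delta> \<le> 1" and a: "1 / 2 \<le> a" "a \<le> 3 / 2" for \<delta> a :: real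
  proof -
    have "(1 / 3) ^ (d - 2) * (c * \<delta> ^ d) * (1 / 6) / I \<le> walk_transform d (1 / \<delta>) (Suc m) (a\<^sup>2)"
      unfolding I_def
    proof (rule walk_transform_Suc_ge_near_1[OF d _ a])
      fix b :: real assume "\<bar>b - 1\<bar> \<le> 1 / 2"
      then have "1 / 2 \<le> b" "b \<le> 3 / 2" by linarith+
      then show "c * \<delta> ^ d \<le> walk_transform d (1 / \<delta>) m (b\<^sup>2)" by (rule le[OF \<delta>])
    qed (use \<delta> c in auto)
    then show ?thesis by (simp add: c'_def mult_ac)
  qed
  ultimately show ?case by blast
qed

text \<open>With the factor exp(-(psi / sigma)^2) and psi = sigma r, the integral becomes sigma^d
  times a walk transform that is at least c sigma^(-d). The bound c does not depend on sigma, so it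
  survives the removal of the Gaussian by dominated convergence with majorant |F|.\<close>

lemma bessel_power_integral_pos:
  assumes "d \<ge> 3" "q \<ge> 3"
  defines "F \<equiv> \<lambda>\<psi>. bessel_series d (\<psi>\<^sup>2) ^ q * \<psi> ^ (d - 1)"
  assumes F: "F absolutely_integrable_on {0..}"
  shows "integral {0..} F > 0"
proof -
  define B where "B = bessel_series d"
  have B_le: "\<bar>B t\<bar> \<le> 1" if "t \<ge> 0" for t
    using abs_bessel_series_le_1[OF assms(1) that] by (simp add: B_def)
  have [measurable]: "B \<in> borel_measurable borel"
    unfolding B_def using assms(1) by (intro borel_measurable_continuous_onI continuous_on_bessel_series) auto
  obtain c where c: "c > 0" "\<And>\<delta> a. 0 < \<delta> \<Longrightarrow> \<delta> \<le> 1 \<Longrightarrow> 1 / 2 \<le> a \<Longrightarrow> a \<le> 3 / 2 \<Longrightarrow> c * \<delta> ^ d \<le> walk_transform d (1 / \<delta>) (q - 1) (a\<^sup>2)"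
  proof -
    have "q - 1 \<ge> 2" using assms(2) by simp
    from walk_transform_ge[OF assms(1) this] show ?thesis using that by blast
  qed
  define G where "G = (\<lambda>n \<psi>. F \<psi> * exp (- (\<psi> / real (Suc n))\<^sup>2))"
  have G: "G n integrable_on {0..}" "integral {0..} (G n) \<ge> c" for n
  proof -
    define \<sigma> where "\<sigma> = real (Suc n)"
    have \<sigma>: "\<sigma> \<ge> 1" by (simp add: \<sigma>_def)
    define f where "f = (\<lambda>\<psi>. indicator {0..} \<psi> *\<^sub>R G n \<psi>)"
    have f: "f (0 + \<sigma> * r) = \<sigma> ^ (d - 1) * (B ((\<sigma> * r)\<^sup>2) ^ q * gauss_kernel d r)" for r
      using \<sigma> by (auto simp: f_def G_def F_def B_def gauss_kernel_def \<sigma>_def[symmetric] indicator_def zero_le_mult_iff power_mult_distrib simp del: of_nat_Suc)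
    have int: "integrable lborel (\<lambda>r. B ((\<sigma> * r)\<^sup>2) ^ q * gauss_kernel d r)"
    proof (rule Bochner_Integration.integrable_bound[OF integrable_gauss_kernel[of d]])
      show "AE r in lborel. norm (B ((\<sigma> * r)\<^sup>2) ^ q * gauss_kernel d r) \<le> norm (gauss_kernel d r)"
      proof (rule AE_I2)
        fix r
        have "\<bar>B ((\<sigma> * r)\<^sup>2)\<bar> ^ q \<le> 1" by (intro power_le_one B_le) auto
        then show "norm (B ((\<sigma> * r)\<^sup>2) ^ q * gauss_kernel d r) \<le> norm (gauss_kernel d r)"
          by (simp add: abs_mult power_abs mult_left_le_one_le)
      qed
    qed measurable
    then have "integrable lborel (\<lambda>r. f (0 + \<sigma> * r))" unfolding f by (rule integrable_mult_right)
    then have "integrable lborel f" using \<sigma> by (subst (asm) lborel_integrable_real_affine_iff) auto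
    then have "set_integrable lborel {0..} (G n)" by (simp add: set_integrable_def f_def)
    note set_borel_integral_eq_integral[OF this]
    then show "G n integrable_on {0..}" by simp
    have "integral {0..} (G n) = (LINT \<psi>|lborel. f \<psi>)"
      using \<open>(LINT x : {0..}|lborel. G n x) = integral {0..} (G n)\<close> by (simp add: set_lebesgue_integral_def f_def)
    also have "\<dots> = \<sigma> * (LINT r|lborel. f (0 + \<sigma> * r))"
      using lborel_integral_real_affine[of \<sigma> f 0] \<sigma> by simp
    also have "\<dots> = (\<sigma> * \<sigma> ^ (d - 1)) * (LINT r|lborel. B ((\<sigma> * r)\<^sup>2) ^ q * gauss_kernel d r)"
      unfolding f by simp
    also have "\<sigma> * \<sigma> ^ (d - 1) = \<sigma> ^ d" using assms(1) by (cases d) auto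
    \<comment> \<open>One of the q factors is read as j(sigma r a) with a = 1, which leaves q - 1 >=
      2 steps, the range of \<open>walk_transform_ge\<close>.\<close>
    also have "(LINT r|lborel. B ((\<sigma> * r)\<^sup>2) ^ q * gauss_kernel d r) = walk_transform d (1 / (1 / \<sigma>)) (q - 1) (1\<^sup>2)"
    proof -
      have "q = Suc (q - 1)" using assms(2) by simp
      then have "B t ^ q = B t * B t ^ (q - 1)" for t by (metis power_Suc)
      then show ?thesis by (simp add: walk_transform_def B_def)
    qed
    also have "\<sigma> ^ d * \<dots> \<ge> \<sigma> ^ d * (c * (1 / \<sigma>) ^ d)"
      using \<sigma> by (intro mult_left_mono c(2)) auto
    also have "\<sigma> ^ d * (c * (1 / \<sigma>) ^ d) = c" using \<sigma> by (simp add: power_divide)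
    finally show "integral {0..} (G n) \<ge> c" .
  qed
  have "(\<lambda>n. integral {0..} (G n)) \<longlonglongrightarrow> integral {0..} F"
  proof (rule dominated_convergence(2))
    show "G n integrable_on {0..}" for n by (rule G)
    show "(\<lambda>\<psi>. norm (F \<psi>)) integrable_on {0..}" using F by (simp add: absolutely_integrable_on_def)
    show "norm (G n \<psi>) \<le> norm (F \<psi>)" for n \<psi> by (simp add: G_def abs_mult mult_right_le_one_le)
    show "(\<lambda>n. G n \<psi>) \<longlonglongrightarrow> F \<psi>" for \<psi>
    proof -
      have "(\<lambda>n. F \<psi> * exp (- (\<psi> / real (Suc n))\<^sup>2)) \<longlonglongrightarrow> F \<psi> * exp (- 0\<^sup>2)"
        by (intro tendsto_intros LIMSEQ_Suc[OF lim_const_over_n])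
      then show ?thesis by (simp add: G_def)
    qed
  qed
  then have "c \<le> integral {0..} F"
    by (rule LIMSEQ_le_const) (use G in blast)
  then show ?thesis using c(1) by linarith
qed

subsection \<open>The case $d = q = 3$\<close>

text \<open>For d = 3 multiplication by sine removes the first-order term: the difference z of the
  two sides satisfies z'' + N^2 z = 0 with N = n + 1 and zero initial data, so its conserved energy
  is 0. In other words G is U_n / (n + 1) with the Chebyshev polynomial of the second kind.\<close>

lemma gegenbauer_3_altdef: "sin \<theta> * gegenbauer_G n 3 (cos \<theta>) = sin (real (Suc n) * \<theta>) / real (Suc n)"
proof -
  have "(3::nat) > 0" by simp
  from gegenbauer_ode[OF this, of n] obtain y1 y2 where y:
    "\<And>x. (gegenbauer_G n 3 has_real_derivative y1 x) (at x)"
    "\<And>x. (y1 has_real_derivative y2 x) (at x)"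
    "\<And>x. (1 - x\<^sup>2) * y2 x - real 3 * x * y1 x + real n * (real n + real 3 - 1) * gegenbauer_G n 3 x = 0"
    by blast
  define g where "g = gegenbauer_G n 3"
  define N where "N = real (Suc n)"
  have N: "N > 0" "N\<^sup>2 = real n * (real n + 2) + 1" by (auto simp: N_def power2_eq_square algebra_simps)
  define z where "z = (\<lambda>t. sin t * g (cos t) - sin (N * t) / N)"
  define z1 where "z1 = (\<lambda>t. cos t * g (cos t) - (sin t)\<^sup>2 * y1 (cos t) - cos (N * t))"
  have dy: "((\<lambda>t. g (cos t)) has_real_derivative y1 (cos t) * (- sin t)) (at t)"
    "((\<lambda>t. y1 (cos t)) has_real_derivative y2 (cos t) * (- sin t)) (at t)" for t
    unfolding g_def by (rule DERIV_chain2[OF y(1) DERIV_cos], rule DERIV_chain2[OF y(2) DERIV_cos])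
  have dz: "(z has_real_derivative z1 t) (at t)" for t
    unfolding z_def z1_def using N(1)
    by (auto intro!: derivative_eq_intros dy simp: power2_eq_square)
  have dz1: "(z1 has_real_derivative - (N\<^sup>2 * z t)) (at t)" for t
  proof -
    have "(z1 has_real_derivative (- sin t * g (cos t) + (y1 (cos t) * (- sin t)) * cos t)
        - (2 * sin t * cos t * y1 (cos t) + (y2 (cos t) * (- sin t)) * (sin t)\<^sup>2) - (- sin (N * t) * N)) (at t)"
      unfolding z1_def by (auto intro!: derivative_eq_intros dy simp: algebra_simps)
    also have "(- sin t * g (cos t) + (y1 (cos t) * (- sin t)) * cos t)
        - (2 * sin t * cos t * y1 (cos t) + (y2 (cos t) * (- sin t)) * (sin t)\<^sup>2) - (- sin (N * t) * N)
       = sin t * ((1 - (cos t)\<^sup>2) * y2 (cos t) - 3 * cos t * y1 (cos t)) - sin t * g (cos t) + N * sin (N * t)"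
      by (simp add: sin_squared_eq algebra_simps)
    also have "(1 - (cos t)\<^sup>2) * y2 (cos t) - 3 * cos t * y1 (cos t) = - (real n * (real n + 2)) * g (cos t)"
    proof -
      have "(1 - (cos t)\<^sup>2) * y2 (cos t) - 3 * cos t * y1 (cos t) + real n * (real n + 2) * g (cos t) = 0"
        using y(3)[of "cos t"] by (simp add: g_def add.commute)
      then show ?thesis by (simp only: eq_neg_iff_add_eq_0 mult_minus_left)
    qed
    also have "sin t * (- (real n * (real n + 2)) * g (cos t)) - sin t * g (cos t) + N * sin (N * t) = - (N\<^sup>2 * z t)"
    proof -
      have "- (N\<^sup>2 * z t) = - N\<^sup>2 * (sin t * g (cos t)) + N * sin (N * t)"
        using N(1) by (simp add: z_def power2_eq_square field_simps)
      then show ?thesis unfolding N(2) by (simp add: algebra_simps)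
    qed
    finally show ?thesis .
  qed
  define e where "e = (\<lambda>t. (z1 t)\<^sup>2 + N\<^sup>2 * (z t)\<^sup>2)"
  have "(e has_real_derivative 0) (at t)" for t
    unfolding e_def by (auto intro!: derivative_eq_intros dz dz1 simp: algebra_simps)
  then have "e \<theta> = e 0" by (intro DERIV_isconst_all) auto
  also have "e 0 = 0" using gegenbauer_G_1[of 3 n] by (simp add: e_def z_def z1_def g_def)
  finally have "(z1 \<theta>)\<^sup>2 + N\<^sup>2 * (z \<theta>)\<^sup>2 = 0" by (simp add: e_def)
  then have "N\<^sup>2 * (z \<theta>)\<^sup>2 = 0"
    using zero_le_power2[of "z1 \<theta>"] zero_le_power2[of "N * z \<theta>"] unfolding power_mult_distrib by linarith
  then show ?thesis using N(1) by (simp add: z_def g_def N_def)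
qed

text \<open>Both sides are limits of the same sequence: the left one by Mehler-Heine, the right one
  by \<open>gegenbauer_3_altdef\<close>.\<close>

lemma bessel_series_3:
  assumes "\<psi> \<ge> 0"
  shows "\<psi> * bessel_series 3 (\<psi>\<^sup>2) = sin \<psi>"
proof (rule LIMSEQ_unique)
  show "(\<lambda>n. real (Suc n) * sin (\<psi> / real (Suc n)) * gegenbauer_G (Suc n) 3 (cos (\<psi> / real (Suc n)))) \<longlonglongrightarrow> \<psi> * bessel_series 3 (\<psi>\<^sup>2)"
    using assms by (intro tendsto_intros tendsto_mult_sin_divide LIMSEQ_Suc[OF Mehler_Heine]) auto
  have "(\<lambda>n. sin ((1 + 1 / real (Suc n)) * \<psi>) / (1 + 1 / real (Suc n))) \<longlonglongrightarrow> sin ((1 + 0) * \<psi>) / (1 + 0)"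
    by (intro tendsto_intros LIMSEQ_Suc[OF lim_const_over_n]) auto
  moreover have "real (Suc n) * sin (\<psi> / real (Suc n)) * gegenbauer_G (Suc n) 3 (cos (\<psi> / real (Suc n)))
     = sin ((1 + 1 / real (Suc n)) * \<psi>) / (1 + 1 / real (Suc n))" for n
  proof -
    define N where "N = real (Suc n)"
    have N: "N > 0" "real (Suc (Suc n)) = N + 1" by (auto simp: N_def)
    have "N * sin (\<psi> / N) * gegenbauer_G (Suc n) 3 (cos (\<psi> / N)) = N * (sin ((N + 1) * (\<psi> / N)) / (N + 1))"
      using gegenbauer_3_altdef[of "\<psi> / N" "Suc n"] by (simp only: N mult.assoc)
    also have "(N + 1) * (\<psi> / N) = (1 + 1 / N) * \<psi>" using N by (simp add: field_simps)
    also have "N * (sin ((1 + 1 / N) * \<psi>) / (N + 1)) = sin ((1 + 1 / N) * \<psi>) / (1 + 1 / N)"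
    proof -
      have "1 + 1 / N = (N + 1) / N" using N by (simp add: field_simps)
      then show ?thesis by simp
    qed
    finally show ?thesis by (simp only: N_def)
  qed
  ultimately show "(\<lambda>n. real (Suc n) * sin (\<psi> / real (Suc n)) * gegenbauer_G (Suc n) 3 (cos (\<psi> / real (Suc n)))) \<longlonglongrightarrow> sin \<psi>"
    by simp
qed

section \<open>Dirichlet integrals over a quarter period\<close>

lemma LIMSEQ_even_odd:
  fixes f :: "nat \<Rightarrow> real"
  assumes "(\<lambda>m. f (2 * m)) \<longlonglongrightarrow> L" "(\<lambda>m. f (2 * m + 1)) \<longlonglongrightarrow> L"
  shows "f \<longlonglongrightarrow> L"
proof (rule LIMSEQ_I)
  fix r :: real assume "r > 0"
  obtain M1 M2 where M: "\<And>m. m \<ge> M1 \<Longrightarrow> norm (f (2 * m) - L) < r" "\<And>m. m \<ge> M2 \<Longrightarrow> norm (f (2 * m + 1) - L) < r"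
    using LIMSEQ_D[OF assms(1) \<open>r > 0\<close>] LIMSEQ_D[OF assms(2) \<open>r > 0\<close>] by blast
  have "norm (f n - L) < r" if "n \<ge> 2 * max M1 M2" for n
  proof (cases "even n")
    case True
    then obtain m where "n = 2 * m" by (elim evenE)
    then show ?thesis using M(1)[of m] that by simp
  next
    case False
    then obtain m where "n = 2 * m + 1" by (elim oddE)
    then show ?thesis using M(2)[of m] that by simp
  qed
  then show "\<exists>no. \<forall>n\<ge>no. norm (f n - L) < r" by blast
qed

fun dirichlet_value :: "nat \<Rightarrow> real" where
  "dirichlet_value 0 = 0"
| "dirichlet_value (Suc 0) = pi / 2"
| "dirichlet_value (Suc (Suc n)) = dirichlet_value n + 2 * sin (real (Suc n) * (pi / 2)) / real (Suc n)"

text \<open>The recursion integrates sin((n+2) theta) - sin(n theta) = 2 cos((n+1) theta) sin theta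
  after division by sin theta.\<close>

lemma has_integral_dirichlet_value:
  "((\<lambda>\<theta>. sin (real n * \<theta>) / sin \<theta>) has_integral dirichlet_value n) {0..pi / 2}"
proof (induction n rule: dirichlet_value.induct)
  case 2
  \<comment> \<open>At 0 the quotient 0 / 0 is 0 instead of 1, hence the exceptional point.\<close>
  have sp: "sin \<theta> / sin \<theta> = 1" if "\<theta> \<in> {0..pi / 2} - {0}" for \<theta> :: real
    using that sin_gt_zero[of \<theta>] pi_gt_zero by force
  have "((\<lambda>\<theta>::real. 1) has_integral (pi / 2)) {0..pi / 2}"
    using has_integral_const_real[of "1::real" 0 "pi / 2"] by simp
  then have "((\<lambda>\<theta>. sin \<theta> / sin \<theta>) has_integral (pi / 2)) {0..pi / 2}"
    by (rule has_integral_spike_finite[of "{0}", rotated 2]) (use sp in auto)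
  then show ?case by simp
next
  case (3 n)
  have "((\<lambda>\<theta>. 2 * cos (real (Suc n) * \<theta>)) has_integral (2 * sin (real (Suc n) * (pi / 2)) / real (Suc n) - 2 * sin (real (Suc n) * 0) / real (Suc n))) {0..pi / 2}"
  proof (rule fundamental_theorem_of_calculus)
    fix \<theta> :: real
    have "((\<lambda>\<theta>. 2 * sin (real (Suc n) * \<theta>) / real (Suc n)) has_real_derivative 2 * cos (real (Suc n) * \<theta>)) (at \<theta>)"
      by (auto intro!: derivative_eq_intros simp del: of_nat_Suc)
    then show "((\<lambda>\<theta>. 2 * sin (real (Suc n) * \<theta>) / real (Suc n)) has_vector_derivative 2 * cos (real (Suc n) * \<theta>)) (at \<theta> within {0..pi / 2})"
      by (simp add: has_real_derivative_iff_has_vector_derivative has_vector_derivative_at_within del: of_nat_Suc)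
  qed simp
  from has_integral_add[OF 3 this]
  have "((\<lambda>\<theta>. sin (real n * \<theta>) / sin \<theta> + 2 * cos (real (Suc n) * \<theta>)) has_integral dirichlet_value (Suc (Suc n))) {0..pi / 2}"
    by (simp del: of_nat_Suc)
  then show ?case
  proof (rule has_integral_spike_finite[of "{0}", rotated 2])
    fix \<theta> :: real assume "\<theta> \<in> {0..pi / 2} - {0}"
    then have s: "sin \<theta> > 0" using pi_gt_zero by (intro sin_gt_zero) auto
    have "sin (real (Suc (Suc n)) * \<theta>) - sin (real n * \<theta>) = 2 * cos (real (Suc n) * \<theta>) * sin \<theta>"
    proof -
      have "real (Suc (Suc n)) * \<theta> = real (Suc n) * \<theta> + \<theta>" "real n * \<theta> = real (Suc n) * \<theta> - \<theta>"
        by (simp_all add: algebra_simps)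
      then show ?thesis by (simp only: sin_add sin_diff)
    qed
    then show "sin (real (Suc (Suc n)) * \<theta>) / sin \<theta> = sin (real n * \<theta>) / sin \<theta> + 2 * cos (real (Suc n) * \<theta>)"
      using s by (simp add: field_simps del: of_nat_Suc)
  qed auto
qed simp

text \<open>For odd n the added sines vanish and the value is constantly pi/2; for even n the values
  are twice the partial sums of the Leibniz series for pi/4.\<close>

lemma dirichlet_value_limit: "dirichlet_value \<longlonglongrightarrow> pi / 2"
proof (rule LIMSEQ_even_odd)
  have odd: "dirichlet_value (2 * m + 1) = pi / 2" for m
  proof (induction m)
    case (Suc m)
    have "real (Suc (2 * m + 1)) * (pi / 2) = real (Suc m) * pi" by (simp add: algebra_simps)
    then have "sin (real (Suc (2 * m + 1)) * (pi / 2)) = 0" by (simp only: sin_npi)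
    then show ?case using Suc by simp
  qed simp
  show "(\<lambda>m. dirichlet_value (2 * m + 1)) \<longlonglongrightarrow> pi / 2" unfolding odd by (rule tendsto_const)
  have even: "dirichlet_value (2 * m) = 2 * (\<Sum>k<m. (-1) ^ k * (1 / real (k * 2 + 1)))" for m
  proof (induction m)
    case (Suc m)
    have "real (Suc (2 * m)) * (pi / 2) = real m * pi + pi / 2" by (simp add: algebra_simps)
    then have "sin (real (Suc (2 * m)) * (pi / 2)) = (-1) ^ m" by (simp only: sin_add cos_npi sin_npi) simp
    then show ?case using Suc by (simp add: algebra_simps)
  qed simp
  have "summable (\<lambda>k. (-1) ^ k * (1 / real (k * 2 + 1) * 1 ^ (k * 2 + 1)))"
    by (rule summable_arctan_series) simp
  then have "(\<lambda>k. (-1) ^ k * (1 / real (k * 2 + 1))) sums (pi / 4)"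
    using summable_sums[of "\<lambda>k. (-1) ^ k * (1 / real (k * 2 + 1)) :: real"] by (simp add: pi_series)
  then have "(\<lambda>m. 2 * (\<Sum>k<m. (-1) ^ k * (1 / real (k * 2 + 1)))) \<longlonglongrightarrow> 2 * (pi / 4)"
    unfolding sums_def by (rule tendsto_mult_left)
  then show "(\<lambda>m. dirichlet_value (2 * m)) \<longlonglongrightarrow> pi / 2" unfolding even by simp
qed

lemma sin_cubed: "sin x ^ 3 = (3 * sin x - sin (3 * x)) / 4" for x :: real
proof -
  have c: "cos x * cos x = 1 - sin x * sin x"
    using cos_squared_eq[of x] by (simp only: power2_eq_square)
  have "sin (3 * x) = sin (2 * x + x)" by simp
  also have "\<dots> = 2 * sin x * (cos x * cos x) + (1 - 2 * (sin x)\<^sup>2) * sin x"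
    unfolding sin_add sin_double cos_double_sin by simp
  finally show ?thesis unfolding c by (simp add: power2_eq_square power3_eq_cube algebra_simps)
qed

text \<open>With N = n + 1 the integrand is sin^3(N theta) / (N^3 sin theta). The triple-angle
  formula splits it into Dirichlet kernels of orders N and 3 N, whose integrals both tend to pi/2,
  so the limit is (3 - 1)/4 * pi/2. The factor (n / (n + 1))^3 tends to 1.\<close>

lemma gegenbauer_moment_limit_3_3:
  "(\<lambda>n. real n ^ 3 * integral {0..pi / 2} (\<lambda>\<theta>. gegenbauer_G n 3 (cos \<theta>) ^ 3 * sin \<theta> ^ 2)) \<longlonglongrightarrow> pi / 4"
proof -
  have I: "integral {0..pi / 2} (\<lambda>\<theta>. gegenbauer_G n 3 (cos \<theta>) ^ 3 * sin \<theta> ^ 2) = ((3 * dirichlet_value (Suc n) - dirichlet_value (3 * Suc n)) / 4) / real (Suc n) ^ 3" for n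
  proof (rule integral_unique)
    define N where "N = real (Suc n)"
    have N: "N > 0" by (simp add: N_def)
    have "((\<lambda>\<theta>. ((3 * (sin (N * \<theta>) / sin \<theta>) - sin (real (3 * Suc n) * \<theta>) / sin \<theta>) / 4) / N ^ 3) has_integral ((3 * dirichlet_value (Suc n) - dirichlet_value (3 * Suc n)) / 4) / N ^ 3) {0..pi / 2}"
      unfolding N_def by (intro has_integral_divide has_integral_diff has_integral_mult_right has_integral_dirichlet_value)
    then show "((\<lambda>\<theta>. gegenbauer_G n 3 (cos \<theta>) ^ 3 * sin \<theta> ^ 2) has_integral ((3 * dirichlet_value (Suc n) - dirichlet_value (3 * Suc n)) / 4) / real (Suc n) ^ 3) {0..pi / 2}"
      unfolding N_def[symmetric]
    proof (rule has_integral_spike_finite[of "{0}", rotated 2])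
      fix \<theta> :: real assume "\<theta> \<in> {0..pi / 2} - {0}"
      then have s: "sin \<theta> > 0" using pi_gt_zero by (intro sin_gt_zero) auto
      have "gegenbauer_G n 3 (cos \<theta>) = sin (N * \<theta>) / (N * sin \<theta>)"
        using gegenbauer_3_altdef[of \<theta> n] s N unfolding N_def[symmetric] by (simp add: field_simps)
      moreover have "(S / (N * s)) ^ 3 * s ^ 2 = (S ^ 3 / s) / N ^ 3" if "s > 0" for S s
        using that N by (simp add: power2_eq_square power3_eq_cube mult_ac)
      ultimately have "gegenbauer_G n 3 (cos \<theta>) ^ 3 * sin \<theta> ^ 2 = (sin (N * \<theta>) ^ 3 / sin \<theta>) / N ^ 3"
        using s by simp
      also have "sin (N * \<theta>) ^ 3 / sin \<theta> = (3 * (sin (N * \<theta>) / sin \<theta>) - sin (real (3 * Suc n) * \<theta>) / sin \<theta>) / 4"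
      proof -
        have *: "real (3 * Suc n) * \<theta> = 3 * (N * \<theta>)" by (simp add: N_def)
        show ?thesis unfolding sin_cubed * by (simp add: diff_divide_distrib mult.commute)
      qed
      finally show "gegenbauer_G n 3 (cos \<theta>) ^ 3 * sin \<theta> ^ 2 = ((3 * (sin (N * \<theta>) / sin \<theta>) - sin (real (3 * Suc n) * \<theta>) / sin \<theta>) / 4) / N ^ 3" .
    qed auto
  qed
  have "(\<lambda>n. dirichlet_value (Suc n)) \<longlonglongrightarrow> pi / 2" by (rule LIMSEQ_Suc[OF dirichlet_value_limit])
  moreover have "filterlim (\<lambda>n. 3 * Suc n) sequentially sequentially"
    by (intro filterlim_subseq) (simp add: strict_mono_def)
  then have "(\<lambda>n. dirichlet_value (3 * Suc n)) \<longlonglongrightarrow> pi / 2" by (rule filterlim_compose[OF dirichlet_value_limit])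
  ultimately have "(\<lambda>n. (1 - 1 / real (Suc n)) ^ 3 * ((3 * dirichlet_value (Suc n) - dirichlet_value (3 * Suc n)) / 4)) \<longlonglongrightarrow> (1 - 0) ^ 3 * ((3 * (pi / 2) - pi / 2) / 4)"
    by (intro tendsto_intros LIMSEQ_Suc[OF lim_const_over_n]) auto
  moreover have "(1 - 1 / real (Suc n)) ^ 3 * x = real n ^ 3 * (x / real (Suc n) ^ 3)" for n x
  proof -
    have "1 - 1 / real (Suc n) = real n / real (Suc n)" by (simp add: field_simps)
    then show ?thesis by (simp add: power_divide del: of_nat_Suc)
  qed
  ultimately show ?thesis unfolding I by (simp add: mult.commute[of 4])
qed

section \<open>The improper integral of sin^3 x / x and its conditional convergence\<close>

lemma has_integral_sinc:
  assumes "b \<ge> 0"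
  shows "((\<lambda>x. sin x / x) has_integral Si b) {0..b}"
proof -
  have cont: "continuous_on {0..b} (\<lambda>x. sinc x)" by (intro continuous_intros)
  have "Si b = (LBINT x=ereal 0..ereal b. sinc x)" by (simp add: Si_alt_def zero_ereal_def)
  also have "\<dots> = integral {0..b} sinc"
    by (rule interval_integral_eq_integral[OF assms borel_integrable_atLeastAtMost'[OF cont]])
  finally have "(sinc has_integral Si b) {0..b}"
    using integrable_continuous_interval[OF cont] by (simp add: integrable_integral)
  then show ?thesis by (rule has_integral_spike_finite[of "{0}", rotated 2]) auto
qed

lemma has_integral_sin_cubed_div:
  assumes "b \<ge> 0"
  shows "((\<lambda>x. sin x ^ 3 / x) has_integral (3 * Si b - Si (3 * b)) / 4) {0..b}"
proof -
  have "((\<lambda>x. sin x / x) has_integral Si (3 * b)) {0..3 * b}" using assms by (intro has_integral_sinc) auto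
  from has_integral_stretch_real[OF this, of 3]
  have "((\<lambda>x. sin (3 * x) / (3 * x)) has_integral Si (3 * b) / 3) ((\<lambda>x. x / 3) ` {0..3 * b})" by simp
  also have "(\<lambda>x::real. x / 3) ` {0..3 * b} = {0..b}"
    using image_mult_atLeastAtMost[of "1 / 3 :: real" 0 "3 * b"] by (simp add: mult.commute)
  finally have "((\<lambda>x. 3 * (sin (3 * x) / (3 * x))) has_integral 3 * (Si (3 * b) / 3)) {0..b}"
    by (rule has_integral_mult_right)
  then have "((\<lambda>x. sin (3 * x) / x) has_integral Si (3 * b)) {0..b}" by simp
  then have "((\<lambda>x. (3 * (sin x / x) - sin (3 * x) / x) / 4) has_integral (3 * Si b - Si (3 * b)) / 4) {0..b}"
    by (intro has_integral_divide has_integral_diff has_integral_mult_right has_integral_sinc assms)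
  then show ?thesis by (simp add: sin_cubed diff_divide_distrib mult.commute)
qed

text \<open>A box [a, b] that contains a large ball around 0 has a <= 0 and b large, so the integral
  over it is I b. This passes from a conditionally convergent improper integral to the gauge
  integral on the half-line.\<close>

lemma has_integral_atLeast_improper:
  fixes f :: "real \<Rightarrow> real"
  assumes f: "\<And>b. b \<ge> 0 \<Longrightarrow> (f has_integral I b) {0..b}" and lim: "(I \<longlongrightarrow> L) at_top"
  shows "(f has_integral L) {0..}"
  unfolding has_integral_alt'
proof (intro conjI allI impI)
  have *: "((\<lambda>x. if x \<in> {0..} then f x else 0) has_integral (if b \<ge> 0 then I b else 0)) {a..b}" if "a \<le> 0" for a b
  proof (cases "b \<ge> 0")
    case True
    then have "{0..b} = {0..} \<inter> {a..b}" using that by auto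
    then show ?thesis using f[OF True] True by (simp only: has_integral_restrict_Int if_True)
  next
    case False
    have "((\<lambda>x. if x \<in> {0..} then f x else 0) has_integral 0) {a..b}"
      by (rule has_integral_is_0) (use False in auto)
    then show ?thesis using False by simp
  qed
  show "(\<lambda>x. if x \<in> {0..} then f x else 0) integrable_on cbox a b" for a b
  proof -
    have "(\<lambda>x. if x \<in> {0..} then f x else 0) integrable_on {min a 0..b}"
      using *[of "min a 0" b] by (auto simp: integrable_on_def)
    then show ?thesis unfolding box_real by (rule integrable_on_subinterval) auto
  qed
  fix e :: real assume "e > 0"
  then obtain N where N: "\<And>b. b \<ge> N \<Longrightarrow> \<bar>I b - L\<bar> < e"
    using tendstoD[OF lim, of e] by (auto simp: eventually_at_top_linorder dist_real_def)
  show "\<exists>B>0. \<forall>a b. ball 0 B \<subseteq> cbox a b \<longrightarrow> norm (integral (cbox a b) (\<lambda>x. if x \<in> {0..} then f x else 0) - L) < e"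
  proof (intro exI[of _ "max 1 N"] conjI allI impI)
    fix a b :: real assume "ball 0 (max 1 N) \<subseteq> cbox a b"
    then have "{- max 1 N<..<max 1 N} \<subseteq> {a..b}" by (simp add: ball_eq_greaterThanLessThan)
    then have "a \<le> - max 1 N" "max 1 N \<le> b" by (auto simp: greaterThanLessThan_subseteq_atLeastAtMost_iff)
    then have ab: "a \<le> 0" "b \<ge> 0" "b \<ge> N" by linarith+
    have "integral (cbox a b) (\<lambda>x. if x \<in> {0..} then f x else 0) = I b"
      using *[OF ab(1), of b] ab(2) by (simp add: integral_unique)
    then show "norm (integral (cbox a b) (\<lambda>x. if x \<in> {0..} then f x else 0) - L) < e" using N[OF ab(3)] by simp
  qed auto
qed

lemma has_integral_sin_cubed_div_atLeast: "((\<lambda>x. sin x ^ 3 / x) has_integral pi / 4) {0..}"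
proof (rule has_integral_atLeast_improper[OF has_integral_sin_cubed_div])
  have "filterlim (\<lambda>b::real. 3 * b) at_top at_top"
    by (rule filterlim_tendsto_pos_mult_at_top[OF tendsto_const _ filterlim_ident]) simp
  then have "((\<lambda>b. Si (3 * b)) \<longlongrightarrow> pi / 2) at_top" by (rule filterlim_compose[OF Si_at_top])
  then have "((\<lambda>b. (3 * Si b - Si (3 * b)) / 4) \<longlongrightarrow> (3 * (pi / 2) - pi / 2) / 4) at_top"
    by (intro tendsto_intros Si_at_top) auto
  then show "((\<lambda>b. (3 * Si b - Si (3 * b)) / 4) \<longlongrightarrow> pi / 4) at_top" by simp
qed

text \<open>
  Adding the translate by $\pi/2$ bounds the integrand below by a multiple of $1/(x + \pi/2)$.
\<close>

lemma not_integrable_abs_sin_cubed_div: "\<not> (\<lambda>x::real. \<bar>sin x ^ 3 / x\<bar>) integrable_on {0..}"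
proof
  define h where "h = (\<lambda>x::real. \<bar>sin x ^ 3 / x\<bar>)"
  assume "(\<lambda>x::real. \<bar>sin x ^ 3 / x\<bar>) integrable_on {0..}"
  then have h: "h integrable_on {0..}" unfolding h_def .
  have h_ab: "h integrable_on {a..b}" if "0 \<le> a" for a b
    using integrable_on_subinterval[OF h, of a b] that by auto
  have h_le: "integral {a..b} h \<le> integral {0..} h" if "0 \<le> a" for a b
    using that by (intro integral_subset_le h h_ab) (auto simp: h_def)
  define c where "c = pi / 2"
  have c: "c > 0" by (simp add: c_def)
  have bound: "(1 / 2) * (ln (b + c) - ln (1 + c)) \<le> 2 * integral {0..} h" if b: "b \<ge> 1" for b
  proof -
    have 1: "((\<lambda>x. (1 / 2) * (1 / (x + c))) has_integral (1 / 2) * (ln (b + c) - ln (1 + c))) {1..b}"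
    proof (rule has_integral_mult_right, rule fundamental_theorem_of_calculus[OF b])
      fix x assume "x \<in> {1..b}"
      then have "((\<lambda>x. ln (x + c)) has_real_derivative 1 / (x + c)) (at x)"
        using c by (auto intro!: derivative_eq_intros)
      then show "((\<lambda>x. ln (x + c)) has_vector_derivative 1 / (x + c)) (at x within {1..b})"
        by (simp add: has_real_derivative_iff_has_vector_derivative has_vector_derivative_at_within)
    qed
    have "(h has_integral integral {1 + c..b + c} h) (cbox (1 + c) (b + c))"
      using h_ab[of "1 + c" "b + c"] c by (simp add: integrable_integral)
    from has_integral_affinity'[OF this, of 1 c]
    have 2: "((\<lambda>x. h (x + c)) has_integral integral {1 + c..b + c} h) {1..b}" by simp
    have 3: "((\<lambda>x. h x) has_integral integral {1..b} h) {1..b}"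
      using h_ab[of 1 b] by (simp add: integrable_integral)
    have "(1 / 2) * (ln (b + c) - ln (1 + c)) \<le> integral {1..b} h + integral {1 + c..b + c} h"
    proof (rule has_integral_le[OF 1 has_integral_add[OF 3 2]])
      fix x assume "x \<in> {1..b}"
      then have x: "x > 0" by simp
      define s where "s = \<bar>sin x\<bar>"
      define t where "t = \<bar>cos x\<bar>"
      have st: "s\<^sup>2 + t\<^sup>2 = 1" "0 \<le> s" "s \<le> 1" "0 \<le> t" "t \<le> 1" by (auto simp: s_def t_def)
      \<comment> \<open>Squaring s^2 + t^2 = 1 gives 1 <= 2 (s^4 + t^4), and cubes dominate fourth
        powers on [0, 1].\<close>
      have "(1 / 2 :: real) \<le> (s\<^sup>2)\<^sup>2 + (t\<^sup>2)\<^sup>2"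
        using zero_le_power2[of "s\<^sup>2 - t\<^sup>2"] arg_cong[OF st(1), of "\<lambda>z. z\<^sup>2"] by (simp add: power2_diff power2_sum)
      also have "\<dots> = s ^ 4 + t ^ 4" by (simp add: power_mult[symmetric])
      also have "\<dots> \<le> s ^ 3 + t ^ 3" using st by (intro add_mono power_decreasing) auto
      finally have key: "1 / 2 \<le> s ^ 3 + t ^ 3" .
      have "sin (x + c) = cos x" by (simp add: c_def sin_add)
      then have "h x + h (x + c) = s ^ 3 / x + t ^ 3 / (x + c)"
        using x c by (simp add: h_def s_def t_def abs_mult power_abs)
      moreover have "s ^ 3 / (x + c) \<le> s ^ 3 / x" using x c st by (intro divide_left_mono) auto
      moreover have "(1 / 2) * (1 / (x + c)) \<le> (s ^ 3 + t ^ 3) * (1 / (x + c))"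
        using key x c by (intro mult_right_mono) auto
      ultimately show "(1 / 2) * (1 / (x + c)) \<le> h x + h (x + c)" by (simp add: add_divide_distrib)
    qed
    also have "\<dots> \<le> integral {0..} h + integral {0..} h" using c by (intro add_mono h_le) auto
    finally show ?thesis by simp
  qed
  \<comment> \<open>The estimate would bound ln (b + c) by K for all b >= 1, which fails at b = max
    1 (exp (K + 1)).\<close>
  define K where "K = 4 * integral {0..} h + ln (1 + c)"
  have "ln (b + c) \<le> K" if "b \<ge> 1" for b using bound[OF that] by (simp add: K_def)
  from this[of "max 1 (exp (K + 1))"] have "ln (max 1 (exp (K + 1)) + c) \<le> K" by simp
  moreover have "ln (exp (K + 1)) \<le> ln (max 1 (exp (K + 1)) + c)"
    using c by (subst ln_le_cancel_iff) (auto intro: add_pos_pos simp: max_def add_increasing2)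
  ultimately show False by simp
qed

text \<open>The prefactor normalises each Bessel factor to psi powr (d/2 - 1) times j; the q
  resulting powers cancel the negative part of the exponent in \<open>c_integrand\<close> and leave
  psi^(d - 1).\<close>

lemma c_integrand_altdef:
  assumes "d \<ge> 2" "\<psi> > 0"
  shows "(2 powr (real d / 2 - 1) * Gamma (real d / 2)) ^ q * c_integrand q d \<psi> = bessel_series d (\<psi>\<^sup>2) ^ q * \<psi> ^ (d - 1)"
proof -
  define \<nu> where "\<nu> = real d / 2 - 1"
  have d: "d > 0" using assms by simp
  have "(2 powr \<nu> * Gamma (real d / 2)) ^ q * c_integrand q d \<psi>
     = (2 powr \<nu> * Gamma (real d / 2) * bessel_J \<nu> \<psi>) ^ q * \<psi> powr (- real q * \<nu> + real d - 1)"
    by (simp add: c_integrand_def \<nu>_def power_mult_distrib)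
  also have "\<dots> = bessel_series d (\<psi>\<^sup>2) ^ q * ((\<psi> powr \<nu>) ^ q * \<psi> powr (- real q * \<nu> + real d - 1))"
    unfolding bessel_J_altdef[OF assms, folded \<nu>_def] by (simp add: power_mult_distrib)
  also have "(\<psi> powr \<nu>) ^ q * \<psi> powr (- real q * \<nu> + real d - 1) = \<psi> powr (real q * \<nu> + (- real q * \<nu> + real d - 1))"
  proof -
    have "(\<psi> powr \<nu>) ^ q = \<psi> powr (real q * \<nu>)" using assms(2) by (simp add: powr_power mult.commute)
    then show ?thesis by (simp only: powr_add)
  qed
  also have "real q * \<nu> + (- real q * \<nu> + real d - 1) = real (d - 1)" using d by (simp add: of_nat_diff)
  also have "\<psi> powr real (d - 1) = \<psi> ^ (d - 1)" using assms(2) by (rule powr_realpow)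
  finally show ?thesis by (simp add: \<nu>_def)
qed

text \<open>The error is forced to be n^d I(n) / L - 1, which is why L must be nonzero; n = 0 is
  excluded by passing to eventual equality.\<close>

lemma asymptotic_equality:
  fixes I :: "nat \<Rightarrow> real"
  assumes "(\<lambda>n. real n ^ d * I n) \<longlonglongrightarrow> L" "L \<noteq> 0"
  shows "\<exists>\<epsilon>. \<epsilon> \<longlonglongrightarrow> 0 \<and> (\<forall>\<^sub>F n in sequentially. I n = L / real n ^ d * (1 + \<epsilon> n))"
proof (intro exI conjI)
  have "(\<lambda>n. real n ^ d * I n / L - 1) \<longlonglongrightarrow> L / L - 1" using assms by (intro tendsto_intros)
  then show "(\<lambda>n. real n ^ d * I n / L - 1) \<longlonglongrightarrow> 0" using assms(2) by simp
  show "\<forall>\<^sub>F n in sequentially. I n = L / real n ^ d * (1 + (real n ^ d * I n / L - 1))"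
    using eventually_gt_at_top[of 0] by eventually_elim (use assms(2) in simp)
qed

subsection \<open>The main result\<close>

theorem proposition5p1p2:
  fixes q d :: nat
  assumes "q \<ge> 3" and "d \<ge> 3"
  shows "(\<exists>\<epsilon> :: nat \<Rightarrow> real. \<epsilon> \<longlonglongrightarrow> 0 \<and>
            (\<forall>\<^sub>F l in sequentially.
               integral {0..pi / 2} (\<lambda>\<theta>. gegenbauer_G l d (cos \<theta>) ^ q * sin \<theta> ^ (d - 1))
                 = c_const q d / real l ^ d * (1 + \<epsilon> l)))
       \<and> ((d, q) \<noteq> (3, 3) \<longrightarrow> c_integrand q d absolutely_integrable_on {0..})
       \<and> ((d, q) = (3, 3) \<longrightarrow> c_integrand q d integrable_on {0..} \<and>
                               \<not> c_integrand q d absolutely_integrable_on {0..})"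
proof -
  define K where "K = (2 powr (real d / 2 - 1) * Gamma (real d / 2)) ^ q"
  have K: "K > 0" using assms by (auto simp: K_def intro!: mult_pos_pos Gamma_real_pos)
  define F where "F = (\<lambda>\<psi>. bessel_series d (\<psi>\<^sup>2) ^ q * \<psi> ^ (d - 1))"
  have eq: "F \<psi> = K * c_integrand q d \<psi>" if "\<psi> \<in> {0..} - {0}" for \<psi>
    using c_integrand_altdef[of d \<psi> q] assms that by (simp add: F_def K_def)
  have c: "c_const q d = integral {0..} F"
  proof -
    have "integral {0..} F = integral {0..} (\<lambda>\<psi>. K * c_integrand q d \<psi>)"
      by (rule integral_spike[of "{0}"]) (use eq in auto)
    then show ?thesis by (simp add: c_const_def K_def)
  qed
  have ci: "c_integrand q d integrable_on {0..} \<longleftrightarrow> F integrable_on {0..}"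
  proof -
    have "F integrable_on {0..} \<longleftrightarrow> (\<lambda>\<psi>. K * c_integrand q d \<psi>) integrable_on {0..}"
      by (rule integrable_spike_finite_eq[of "{0}"]) (use eq in auto)
    then show ?thesis using K by simp
  qed
  have ca: "c_integrand q d absolutely_integrable_on {0..} \<longleftrightarrow> F absolutely_integrable_on {0..}"
  proof -
    have "F absolutely_integrable_on {0..} \<longleftrightarrow> (\<lambda>\<psi>. K * c_integrand q d \<psi>) absolutely_integrable_on {0..}"
      by (rule absolutely_integrable_spike_eq[of "{0}"]) (use eq in auto)
    also have "\<dots> \<longleftrightarrow> c_integrand q d absolutely_integrable_on {0..}"
      using K by (simp add: absolutely_integrable_on_def abs_mult)
    finally show ?thesis by simp
  qed
  show ?thesis
  proof (cases "(d, q) = (3, 3)")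
    case False
    note F = gegenbauer_moment_limit[OF assms(2,1) False, folded F_def]
    have "integral {0..} F > 0"
      unfolding F_def by (rule bessel_power_integral_pos[OF assms(2,1) F(1)[unfolded F_def]])
    then have "c_const q d \<noteq> 0" by (simp add: c)
    from asymptotic_equality[OF F(2)[folded c] this] show ?thesis
      using False F(1) ca by blast
  next
    case True
    then have dq: "d = 3" "q = 3" by auto
    \<comment> \<open>At psi = 0 both sides are 0, the right one by the convention for division by
      0.\<close>
    have F_eq: "F \<psi> = sin \<psi> ^ 3 / \<psi>" if "\<psi> \<in> {0..}" for \<psi>
    proof (cases "\<psi> = 0")
      case False
      have "sin \<psi> ^ 3 / \<psi> = (\<psi> * bessel_series 3 (\<psi>\<^sup>2)) ^ 3 / \<psi>"
        using bessel_series_3[of \<psi>] that by simp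
      also have "\<dots> = F \<psi>" using False by (simp add: F_def dq power_mult_distrib power3_eq_cube power2_eq_square)
      finally show ?thesis by simp
    qed (simp add: F_def dq)
    have "(F has_integral pi / 4) {0..}"
      using has_integral_sin_cubed_div_atLeast by (rule has_integral_eq[rotated]) (use F_eq in simp)
    then have F: "F integrable_on {0..}" "c_const q d = pi / 4" unfolding c by (auto simp: has_integral_iff)
    have "\<not> F absolutely_integrable_on {0..}"
    proof
      assume "F absolutely_integrable_on {0..}"
      then have "(\<lambda>\<psi>. norm (F \<psi>)) integrable_on {0..}" by (simp add: absolutely_integrable_on_def)
      then have "(\<lambda>x::real. \<bar>sin x ^ 3 / x\<bar>) integrable_on {0..}" by (rule integrable_spike_finite[of "{}", rotated 2]) (use F_eq in auto)
      then show False using not_integrable_abs_sin_cubed_div by simp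
    qed
    moreover have "\<exists>\<epsilon>. \<epsilon> \<longlonglongrightarrow> 0 \<and> (\<forall>\<^sub>F l in sequentially.
               integral {0..pi / 2} (\<lambda>\<theta>. gegenbauer_G l d (cos \<theta>) ^ q * sin \<theta> ^ (d - 1))
                 = c_const q d / real l ^ d * (1 + \<epsilon> l))"
      unfolding F(2) using gegenbauer_moment_limit_3_3 by (intro asymptotic_equality) (simp_all add: dq)
    ultimately show ?thesis using True ci ca F(1) by blast
  qed
qed

end
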